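(* Let $p = p(n) \in (0,1]$ satisfy $p \gg \ln n / n$, i.e. $pn/\ln n \to \infty$ as $n \to \infty$, and let $G \in \mathcal{G}(n,p)$. Then asymptotically almost surely $$b_g(G) = (1+o(1))\,p\,b_g(K_n) = (1+o(1))\,p n^2/e,$$ where $K_n$ is the complete graph on $n$ vertices and $e$ is the base of the natural logarithm.
   Context: $\mathcal{G}(n,p)$ is the binomial random graph: the probability space of all graphs on vertex set $\{1,\dots,n\}$ in which each graph $H$ has probability $p^{|E(H)|}(1-p)^{\binom n2 - |E(H)|}$ (each of the $\binom n2$ possible edges is present independently with probability $p$). All asymptotics are as $n\to\infty$. An event holds asymptotically almost surely if its probability tends to $1$ as $n\to\infty$. A statement that a.a.s. $X = (1+o(1))a_n$ means that for every $\varepsilon>0$, the probability that $|X - a_n| \le \varepsilon a_n$ tends to $1$. The brushing game on a graph $G$ is played by two players, Max and Min. Initially all vertices are dirty and no vertex contains any brushes. The players alternate turns. On each turn, the player whose turn it is adds one brush to any dirty vertex. After this, if some dirty vertex $v$ has at least as many brushes as it has dirty neighbors, then $v$ fires: one brush is added to each dirty neighbor of $v$, and $v$ itself is marked clean. Vertices continue to fire, sequentially (in an arbitrary order; the order does not affect the outcome), until no more vertices may fire, at which point the turn ends. If at this point all vertices of $G$ are clean, the game ends. The length of the game is the number of brushes placed by the players (the number of turns). Min aims to minimize it, Max aims to maximize it. The game brush number $b_g(G)$ is the length of the game when Min takes the first turn and both players play optimally. *)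

theory Defs
  imports "HOL-Probability.Probability" "HOL-Library.Landau_Symbols"
begin

section \<open>The brushing game\<close>

text \<open>
  A graph is given by its vertex set and its set of edges, the latter being two-element sets
  of vertices.  A position of the game is a pair \<open>(D, B)\<close> consisting of the set \<open>D\<close> of dirty
  vertices and the number of brushes \<open>B v\<close> at each vertex \<open>v\<close>.
\<close>

type_synonym 'a position = "'a set \<times> ('a \<Rightarrow> nat)"

definition nbrs :: "'a set set \<Rightarrow> 'a set \<Rightarrow> 'a \<Rightarrow> 'a set" where
  "nbrs E D v = {u \<in> D. {u, v} \<in> E}"

text \<open>
  The brushes at a clean vertex play no further role in the game.  They are discarded here, so
  that the position reached is literally independent of the order in which vertices fire.
\<close>

inductive fire :: "'a set set \<Rightarrow> 'a position \<Rightarrow> 'a position \<Rightarrow> bool" for E where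
  "v \<in> D \<Longrightarrow> card (nbrs E D v) \<le> B v \<Longrightarrow>
   fire E (D, B) (D - {v}, (\<lambda>u. if u \<in> nbrs E D v then B u + 1 else B u)(v := 0))"

definition stabilized :: "'a set set \<Rightarrow> 'a position \<Rightarrow> 'a position \<Rightarrow> bool" where
  "stabilized E s t \<longleftrightarrow> (fire E)\<^sup>*\<^sup>* s t \<and> \<not> (\<exists>t'. fire E t t')"

definition stabilize :: "'a set set \<Rightarrow> 'a position \<Rightarrow> 'a position" where
  "stabilize E s = (THE t. stabilized E s t)"

definition turn :: "'a set set \<Rightarrow> 'a \<Rightarrow> 'a position \<Rightarrow> 'a position" where
  "turn E v s = (case s of (D, B) \<Rightarrow> stabilize E (D, B(v := B v + 1)))"

lemma fireE:
  assumes "fire E (D, B) t"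
  obtains v where "v \<in> D" "card (nbrs E D v) \<le> B v"
    "t = (D - {v}, (\<lambda>u. if u \<in> nbrs E D v then B u + 1 else B u)(v := 0))"
  using assms by (cases rule: fire.cases) auto

lemma fire_psubset: "fire E s t \<Longrightarrow> fst t \<subset> fst s"
  by (induction rule: fire.induct) auto

lemma fires_subset: "(fire E)\<^sup>*\<^sup>* s t \<Longrightarrow> t = s \<or> fst t \<subset> fst s"
  by (induction rule: rtranclp_induct) (auto dest: fire_psubset)

lemma ex_stabilized:
  assumes "finite (fst s)"
  shows "\<exists>t. stabilized E s t"
  using assms
proof (induction "card (fst s)" arbitrary: s rule: less_induct)
  case less
  show ?case
  proof (cases "\<exists>t. fire E s t")
    case True
    then obtain t where t: "fire E s t" by blast
    from fire_psubset[OF t] less(2) have "card (fst t) < card (fst s)" "finite (fst t)"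
      by (auto intro: psubset_card_mono finite_subset)
    from less(1)[OF this] t show ?thesis
      unfolding stabilized_def by (meson converse_rtranclp_into_rtranclp)
  next
    case False
    then show ?thesis unfolding stabilized_def by blast
  qed
qed

lemma fire_diamond:
  assumes fin: "finite (fst s)" and "fire E s a" "fire E s b" "a \<noteq> b"
  shows "\<exists>c. fire E a c \<and> fire E b c"
proof -
  obtain D B where s: "s = (D, B)" by (cases s)
  define f where "f = (\<lambda>D B v. (\<lambda>u. if u \<in> nbrs E D v then B u + 1 else B u :: nat)(v := 0))"
  have f: "f D B v = (\<lambda>u. if u \<in> nbrs E D v then B u + 1 else B u)(v := 0)" for D B v
    by (simp add: f_def)
  obtain v where v: "v \<in> D" "card (nbrs E D v) \<le> B v" "a = (D - {v}, f D B v)"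
    using assms(2) unfolding s f_def by (elim fireE)
  obtain w where w: "w \<in> D" "card (nbrs E D w) \<le> B w" "b = (D - {w}, f D B w)"
    using assms(3) unfolding s f_def by (elim fireE)
  have vw: "v \<noteq> w" using v w assms(4) by auto
  have finD: "finite D" using fin s by simp
  have key: "card (nbrs E (D - {x}) y) \<le> f D B x y"
    if "x \<in> D" "y \<in> D" "x \<noteq> y" "card (nbrs E D y) \<le> B y" for x y
  proof -
    have eq: "nbrs E (D - {x}) y = nbrs E D y - {x}" by (auto simp: nbrs_def)
    have "finite (nbrs E D y)" using finD by (simp add: nbrs_def)
    then have "card (nbrs E D y - {x}) \<le> card (nbrs E D y)" by (simp add: card_mono)
    then show ?thesis using that unfolding eq f_def by auto
  qed
  have comm: "f (D - {v}) (f D B v) w = f (D - {w}) (f D B w) v"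
    using vw by (auto simp: f_def nbrs_def fun_eq_iff insert_commute)
  have D: "D - {v} - {w} = D - {w} - {v}" by auto
  have "fire E a (D - {v} - {w}, f (D - {v}) (f D B v) w)"
    unfolding v(3) using v w vw key[of v w] fire.intros[of w "D - {v}" E "f D B v"]
    unfolding f[symmetric] by auto
  moreover have "fire E b (D - {w} - {v}, f (D - {w}) (f D B w) v)"
    unfolding w(3) using v w vw key[of w v] fire.intros[of v "D - {w}" E "f D B w"]
    unfolding f[symmetric] by auto
  ultimately show ?thesis using comm D by auto
qed

lemma stabilized_unique:
  assumes "finite (fst s)" "stabilized E s a" "stabilized E s b"
  shows "a = b"
  using assms
proof (induction "card (fst s)" arbitrary: s a b rule: less_induct)
  case less
  show ?case
  proof (cases "\<exists>t. fire E s t")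
    case False
    then show ?thesis using less(3,4) unfolding stabilized_def
      by (metis converse_rtranclpE)
  next
    case True
    then have "s \<noteq> a" "s \<noteq> b" using less(3,4) by (auto simp: stabilized_def)
    then obtain a1 b1 where a1: "fire E s a1" "stabilized E a1 a"
      and b1: "fire E s b1" "stabilized E b1 b"
      using less(3,4) unfolding stabilized_def by (metis converse_rtranclpE)
    have *: "card (fst t) < card (fst s)" "finite (fst t)" if "fire E s t" for t
      using fire_psubset[OF that] less(2)
      by (auto intro: psubset_card_mono finite_subset)
    show ?thesis
    proof (cases "a1 = b1")
      case True
      then show ?thesis using less(1) * a1 b1 by blast
    next
      case False
      then obtain c where c: "fire E a1 c" "fire E b1 c"
        using fire_diamond[OF less(2) a1(1) b1(1)] by blast
      have "finite (fst c)" using fire_psubset[OF c(1)] *(2)[OF a1(1)] finite_subset by blast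
      then obtain d where d: "stabilized E c d" using ex_stabilized by blast
      then have "stabilized E a1 d" "stabilized E b1 d"
        using c unfolding stabilized_def by (meson converse_rtranclp_into_rtranclp)+
      then show ?thesis using less(1) * a1 b1 by metis
    qed
  qed
qed

lemma stabilized_stabilize:
  assumes "finite (fst s)"
  shows "stabilized E s (stabilize E s)"
  unfolding stabilize_def
  by (rule theI') (use ex_stabilized stabilized_unique assms in blast)

lemma turn_decreases:
  assumes "finite D" "v \<in> D" "turn E v (D, B) = (D', B')"
  shows "card D' < card D \<or> card D' = card D \<and>
    (\<Sum>u\<in>D'. card (nbrs E D' u) - B' u) < (\<Sum>u\<in>D. card (nbrs E D u) - B u)"
proof -
  define B1 where "B1 = B(v := B v + 1)"
  have st: "stabilized E (D, B1) (D', B')"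
    using stabilized_stabilize[of "(D, B1)" E] assms by (simp add: turn_def B1_def)
  then consider "D' = D" "B' = B1" | "D' \<subset> D"
    using fires_subset[of E "(D, B1)" "(D', B')"] by (auto simp: stabilized_def)
  then show ?thesis
  proof cases
    case 1
    have "\<not> card (nbrs E D v) \<le> B1 v"
      using st fire.intros[of v D E B1] assms(2) unfolding 1 stabilized_def by blast
    then have "card (nbrs E D v) - B1 v < card (nbrs E D v) - B v" by (simp add: B1_def)
    then have "(\<Sum>u\<in>D. card (nbrs E D u) - B1 u) < (\<Sum>u\<in>D. card (nbrs E D u) - B u)"
      using assms(1,2) by (intro sum_strict_mono_ex1) (auto simp: B1_def)
    then show ?thesis using 1 by simp
  next
    case 2
    then show ?thesis using assms(1) psubset_card_mono by blast
  qed
qed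

text \<open>
  The number of turns remaining under optimal play (by backward induction); the Boolean tells
  whether it is Min's turn.
\<close>

function game_length :: "'a set set \<Rightarrow> bool \<Rightarrow> 'a position \<Rightarrow> nat" where
  "game_length E min_moves (D, B) =
    (if finite D \<and> D \<noteq> {} then
       if min_moves
       then 1 + Min ((\<lambda>v. game_length E False (turn E v (D, B))) ` D)
       else 1 + Max ((\<lambda>v. game_length E True (turn E v (D, B))) ` D)
     else 0)"
  by pat_completeness auto
termination
proof (relation "measures [\<lambda>(E, m, D, B). card D,
    \<lambda>(E, m, D, B). \<Sum>u\<in>D. card (nbrs E D u) - B u]", goal_cases)
  case 1
  show ?case by simp
next
  case (2 E m D B v)
  then show ?case using turn_decreases[of D v E B] by (cases "turn E v (D, B)") auto
next
  case (3 E m D B v)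
  then show ?case using turn_decreases[of D v E B] by (cases "turn E v (D, B)") auto
qed

declare game_length.simps [simp del]

definition game_brush_number :: "'a set \<Rightarrow> 'a set set \<Rightarrow> nat" where
  "game_brush_number V E = game_length E True (V, \<lambda>_. 0)"


section \<open>The binomial random graph\<close>

definition complete_edges :: "nat \<Rightarrow> nat set set" where
  "complete_edges n = {e. e \<subseteq> {1..n} \<and> card e = 2}"

text \<open>The edge set of the random graph; its vertex set is \<open>{1..n}\<close>.\<close>

definition random_graph :: "nat \<Rightarrow> real \<Rightarrow> nat set set pmf" where
  "random_graph n p = map_pmf (\<lambda>X. {e \<in> complete_edges n. X e})
     (Pi_pmf (complete_edges n) False (\<lambda>_. bernoulli_pmf p))"

lemma finite_complete_edges: "finite (complete_edges n)"
  by (rule finite_subset[of _ "Pow {1..n}"]) (auto simp: complete_edges_def)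

lemma card_complete_edges: "card (complete_edges n) = n choose 2"
  using n_subsets[of "{1..n}" 2] by (simp add: complete_edges_def)

lemma pmf_random_graph:
  assumes "0 \<le> p" "p \<le> 1" "H \<subseteq> complete_edges n"
  shows "pmf (random_graph n p) H = p ^ card H * (1 - p) ^ ((n choose 2) - card H)"
proof -
  let ?K = "complete_edges n"
  let ?P = "Pi_pmf ?K False (\<lambda>_. bernoulli_pmf p)"
  have fin: "finite ?K" by (rule finite_complete_edges)
  have "pmf (random_graph n p) H = measure_pmf.prob ?P ((\<lambda>X. {e \<in> ?K. X e}) -` {H})"
    by (simp add: random_graph_def pmf_map)
  also have "\<dots> = measure_pmf.prob ?P {\<lambda>e. e \<in> H}"
  proof (rule measure_pmf.finite_measure_eq_AE)
    show "AE X in measure_pmf ?P. (X \<in> (\<lambda>X. {e \<in> ?K. X e}) -` {H}) = (X \<in> {\<lambda>e. e \<in> H})"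
      using set_Pi_pmf_subset[OF fin, of False "\<lambda>_. bernoulli_pmf p"] assms(3)
      by (fastforce simp: AE_measure_pmf_iff fun_eq_iff)
  qed auto
  also have "\<dots> = (\<Prod>e\<in>?K. pmf (bernoulli_pmf p) (e \<in> H))"
    using assms(3) fin by (subst measure_pmf_single, subst pmf_Pi') auto
  also have "\<dots> = (\<Prod>e\<in>?K. if e \<in> H then p else 1 - p)"
    using assms by (intro prod.cong) auto
  also have "\<dots> = (\<Prod>e\<in>?K \<inter> H. p) * (\<Prod>e\<in>?K - H. 1 - p)"
    using fin by (simp add: prod.If_cases Diff_eq)
  also have "\<dots> = p ^ card H * (1 - p) ^ ((n choose 2) - card H)"
    using assms(3) fin
    by (simp add: Int_absorb1 card_Diff_subset finite_subset card_complete_edges)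
  finally show ?thesis .
qed

definition aas_asymp :: "(nat \<Rightarrow> 'a pmf) \<Rightarrow> (nat \<Rightarrow> 'a \<Rightarrow> real) \<Rightarrow> (nat \<Rightarrow> real) \<Rightarrow> bool" where
  "aas_asymp M X a \<longleftrightarrow>
     (\<forall>\<epsilon>>0. (\<lambda>n. measure_pmf.prob (M n) {\<omega>. \<bar>X n \<omega> - a n\<bar> \<le> \<epsilon> * a n}) \<longlonglongrightarrow> 1)"

end

theory Submission
  imports Defs
begin

text \<open>
  The proof uses the random graph only through its edge density: a.a.s. between any two sets \<open>S\<close>,
  \<open>T\<close> of vertices there are \<open>p \<bar>S\<bar> \<bar>T\<bar>\<close> adjacent pairs, up to an error that is small compared to
  \<open>p n\<^sup>2\<close>.  This follows from a Chernoff bound and a union bound over the \<open>2\<^sup>n\<close> vertex sets as soon as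
  \<open>p n\<close> tends to infinity (\<open>random_graph_pseudorandom\<close>).  The complete graph has the same property
  with \<open>p = 1\<close> (\<open>pseudorandom_complete\<close>), so that all three claims follow from one deterministic
  statement: a graph whose density is \<open>p\<close> up to the error \<open>p n\<^sup>2 / K\<^sup>2\<close> has game brush number
  \<open>p n\<^sup>2 / e\<close> up to a constant multiple of \<open>p n\<^sup>2 / K\<close> (\<open>game_brush_number_bounds\<close>).

  Where \<open>p n\<^sup>2 / e\<close> comes from: suppose that Min completes one vertex after the other while Max keeps
  the brushes on all other dirty vertices at a common level.  A vertex that fires with exactly as many
  brushes as it has dirty neighbours only passes its brushes on, so the number \<open>R\<close> of brushes on the
  dirty vertices is the number of turns made.  With \<open>m\<close> dirty vertices the degrees within the
  dirty set sum up to \<open>A = p m\<^sup>2\<close>, a vertex lacks \<open>(A - R) / m\<close> brushes, and completing it takes that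
  many turns of each player.  Thus \<open>R\<close> grows by \<open>2 (A - R) / m\<close> while \<open>A\<close> drops by \<open>2 p m\<close>, and
  \<open>A exp (R / A - 1)\<close> is a first integral of this motion.  It equals \<open>p n\<^sup>2 / e\<close> at the start, where
  \<open>R = 0\<close>, and \<open>R\<close> at the end, where \<open>R = A\<close>.

  Upper bound (\<open>game_brush_number_upper\<close>): Min always feeds the vertex that lacks the fewest brushes,
  until some vertex fires.  This vertex lacks at most the average \<open>(A - R) / m\<close>, so
  \<open>A exp (R / A - 1)\<close> hardly increases (\<open>rest_value_phase\<close>), whatever Max does.  Max may prepare many
  vertices that then fire together with more brushes than they need; the brushes lost in such a cascade
  of \<open>k\<close> vertices number about \<open>p k\<^sup>2\<close>, and the degrees lost with the \<open>k\<close> vertices make up for them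
  (\<open>rest_value_avalanche\<close>).

  Lower bound (\<open>game_brush_number_lower\<close>): Max always feeds a dirty vertex on which the players have put
  the fewest brushes so far.  The \<open>j\<close>-th vertex to fire receives a brush from each earlier neighbour
  and has lost these neighbours, so the players themselves must have put about \<open>p (n - 2 j)\<close> brushes on it
  (\<open>missing_brushes_le\<close>).  Min may stockpile brushes on several vertices before letting them fire.  The
  lower estimate for the total length of the game is therefore the least of the numbers \<open>lower_potential x\<close>,
  where \<open>x\<close> stands for the continuation in which Min brings the number of fired vertices to \<open>x\<close> before
  the level rises any further.  As long as \<open>x\<close> does not exceed the number of vertices above the level, a
  turn of Min lowers \<open>lower_potential x\<close> at most by as much as a turn of Max raises it, up to
  \<open>O(1 / n)\<close> (\<open>lower_potential_raise\<close>, \<open>potential_ge_brush\<close>); larger \<open>x\<close> do not yield smaller values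
  (\<open>lower_potential_Suc\<close>).
\<close>

section \<open>Counting edges\<close>

definition edge_count :: "'a set set \<Rightarrow> 'a set \<Rightarrow> 'a set \<Rightarrow> nat" where
  "edge_count E S T = (\<Sum>u\<in>S. card (nbrs E T u))"

lemma card_nbrs_mono: "finite T \<Longrightarrow> S \<subseteq> T \<Longrightarrow> card (nbrs E S u) \<le> card (nbrs E T u)"
  by (rule card_mono) (auto simp: nbrs_def)

lemma card_nbrs_Un:
  assumes "finite S" "finite T" "S \<inter> T = {}"
  shows "card (nbrs E (S \<union> T) u) = card (nbrs E S u) + card (nbrs E T u)"
proof -
  have "nbrs E (S \<union> T) u = nbrs E S u \<union> nbrs E T u" by (auto simp: nbrs_def)
  then show ?thesis using assms by (auto intro!: card_Un_disjoint simp: nbrs_def)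
qed

lemma card_nbrs_eq_sum:
  "finite T \<Longrightarrow> card (nbrs E T u) = (\<Sum>v\<in>T. if {u, v} \<in> E then 1 else 0)"
  by (simp add: nbrs_def insert_commute Int_def flip: sum.inter_filter)

lemma edge_count_commute:
  assumes "finite S" "finite T"
  shows "edge_count E S T = edge_count E T S"
proof -
  have "edge_count E S T = (\<Sum>u\<in>S. \<Sum>v\<in>T. if {u, v} \<in> E then 1 else 0)"
    using assms by (simp add: edge_count_def card_nbrs_eq_sum)
  also have "\<dots> = (\<Sum>v\<in>T. \<Sum>u\<in>S. if {u, v} \<in> E then 1 else 0)" by (rule sum.swap)
  also have "\<dots> = edge_count E T S"
    using assms by (simp add: edge_count_def card_nbrs_eq_sum insert_commute)
  finally show ?thesis .
qed

lemma edge_count_Un_left: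
  "finite S \<Longrightarrow> finite S' \<Longrightarrow> S \<inter> S' = {} \<Longrightarrow>
    edge_count E (S \<union> S') T = edge_count E S T + edge_count E S' T"
  by (simp add: edge_count_def sum.union_disjoint)

lemma edge_count_Un_right:
  "finite T \<Longrightarrow> finite T' \<Longrightarrow> T \<inter> T' = {} \<Longrightarrow>
    edge_count E S (T \<union> T') = edge_count E S T + edge_count E S T'"
  by (simp add: edge_count_def card_nbrs_Un sum.distrib)

text \<open>
  Losses in successive cascades can therefore be estimated by the edges within the union of all
  vertices that fired.
\<close>

lemma edge_count_superadditive:
  assumes "finite S" "finite T" "S \<inter> T = {}"
  shows "edge_count E S S + edge_count E T T \<le> edge_count E (S \<union> T) (S \<union> T)"
  using assms by (simp add: edge_count_Un_left edge_count_Un_right)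


section \<open>The effect of a turn\<close>

definition stable :: "'a set set \<Rightarrow> 'a set \<Rightarrow> ('a \<Rightarrow> nat) \<Rightarrow> bool" where
  "stable E D B \<longleftrightarrow> finite D \<and> (\<forall>u\<in>D. B u < card (nbrs E D u))"

lemma stabilized_turn:
  assumes "finite D"
  shows "stabilized E (D, B(v := B v + 1)) (turn E v (D, B))"
  using stabilized_stabilize[of "(D, B(v := B v + 1))" E] assms by (simp add: turn_def)

text \<open>
  Induction over the vertices that fire in the course of a turn.
\<close>

lemma turn_invariant:
  assumes "finite D" "turn E v (D, B) = (D', B')" "P D (B(v := B v + 1))"
    and step: "\<And>D B v. finite D \<Longrightarrow> P D B \<Longrightarrow> v \<in> D \<Longrightarrow> card (nbrs E D v) \<le> B v \<Longrightarrow>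
      P (D - {v}) ((\<lambda>u. if u \<in> nbrs E D v then B u + 1 else B u)(v := 0))"
  shows "P D' B'"
proof -
  have "(fire E)\<^sup>*\<^sup>* (D, B(v := B v + 1)) (D', B')"
    using stabilized_turn[OF assms(1)] assms(2) by (metis stabilized_def)
  then have "finite (fst (D', B')) \<and> P (fst (D', B')) (snd (D', B'))"
  proof (induction rule: rtranclp_induct)
    case base
    show ?case using assms(1,3) by (simp del: fun_upd_apply)
  next
    case (step s t)
    obtain D B where s: "s = (D, B)" by (cases s)
    from step.hyps(2) step.IH show ?case unfolding s
      by (elim fireE) (use assms(4) in \<open>auto simp del: fun_upd_apply\<close>)
  qed
  then show ?thesis by simp
qed

lemma turn_stable:
  assumes "finite D" "turn E v (D, B) = (D', B')"
  shows "stable E D' B'"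
proof -
  have "finite D'"
    by (rule turn_invariant[OF assms, where P = "\<lambda>D B. finite D"]) (use assms in auto)
  moreover have "B' u < card (nbrs E D' u)" if "u \<in> D'" for u
  proof (rule ccontr)
    assume "\<not> ?thesis"
    then have "\<exists>t. fire E (D', B') t" using fire.intros[OF that, of E B'] by auto
    then show False using stabilized_turn[OF assms(1), of E B v] assms(2) by (auto simp: stabilized_def)
  qed
  ultimately show ?thesis by (simp add: stable_def)
qed

lemma turn_fst_subset:
  assumes "finite D" "turn E v (D, B) = (D', B')"
  shows "D' \<subseteq> D"
  using assms by (rule turn_invariant[where P = "\<lambda>A _. A \<subseteq> D"]) auto

lemma turn_no_fire:
  assumes "finite D" "turn E v (D, B) = (D, B')"
  shows "B' = B(v := B v + 1)"
proof -
  let ?P = "\<lambda>A C. A \<subseteq> D \<and> (A = D \<longrightarrow> C = B(v := B v + 1))"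
  have "?P D B'"
    using assms by (rule turn_invariant[where P = ?P]) blast+
  then show ?thesis by blast
qed

text \<open>
  Every brush on a dirty vertex was either put there by a player or sent by a neighbour that fired.
\<close>

lemma turn_brushes:
  assumes "finite D" "turn E v (D, B) = (D', B')" "u \<in> D'"
  shows "B' u = (B(v := B v + 1)) u + card (nbrs E (D - D') u)"
proof -
  let ?P = "\<lambda>A C. A \<subseteq> D \<and> (\<forall>u\<in>A. C u = (B(v := B v + 1)) u + card (nbrs E (D - A) u))"
  have "?P D' B'"
    using assms(1,2)
  proof (rule turn_invariant[where P = ?P])
    show "?P D (B(v := B v + 1))" by (auto simp: nbrs_def)
  next
    fix A C w
    assume fin: "finite A" and P: "?P A C" and w: "w \<in> A"
    have "card (nbrs E (D - (A - {w})) u) =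
      card (nbrs E (D - A) u) + (if u \<in> nbrs E A w then 1 else 0)" if "u \<in> A - {w}" for u
    proof -
      have "D - (A - {w}) = (D - A) \<union> {w}" using P w by auto
      then have "card (nbrs E (D - (A - {w})) u) = card (nbrs E (D - A) u) + card (nbrs E {w} u)"
        using w assms(1) by (simp only:) (subst card_nbrs_Un, auto)
      moreover have "nbrs E {w} u = (if u \<in> nbrs E A w then {w} else {})"
        using that by (auto simp: nbrs_def insert_commute)
      ultimately show ?thesis by simp
    qed
    then show "?P (A - {w}) ((\<lambda>u. if u \<in> nbrs E A w then C u + 1 else C u)(w := 0))"
      using P by auto
  qed
  then show ?thesis using assms(3) by blast
qed


section \<open>Unfolding the length of the game\<close>

lemma game_length_empty [simp]: "game_length E m ({}, B) = 0"
  by (simp add: game_length.simps)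

lemma game_length_Min_le:
  assumes "finite D" "v \<in> D"
  shows "game_length E True (D, B) \<le> 1 + game_length E False (turn E v (D, B))"
  using assms by (subst game_length.simps) (auto intro!: Min_le)

lemma game_length_Min_attained:
  assumes "finite D" "D \<noteq> {}"
  obtains v where "v \<in> D" "game_length E True (D, B) = 1 + game_length E False (turn E v (D, B))"
proof -
  have "Min ((\<lambda>v. game_length E False (turn E v (D, B))) ` D) \<in>
      (\<lambda>v. game_length E False (turn E v (D, B))) ` D"
    using assms by (intro Min_in) auto
  then obtain v where "v \<in> D" "Min ((\<lambda>v. game_length E False (turn E v (D, B))) ` D)
      = game_length E False (turn E v (D, B))" by auto
  then show ?thesis using assms by (intro that[of v]) (auto simp: game_length.simps[of E True D])
qed

lemma game_length_Max_ge:
  assumes "finite D" "v \<in> D"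
  shows "1 + game_length E True (turn E v (D, B)) \<le> game_length E False (D, B)"
proof -
  have "D \<noteq> {}" using assms by auto
  then show ?thesis using assms by (simp add: game_length.simps[of E False D])
qed

lemma game_length_Max_attained:
  assumes "finite D" "D \<noteq> {}"
  obtains v where "v \<in> D" "game_length E False (D, B) = 1 + game_length E True (turn E v (D, B))"
proof -
  have "Max ((\<lambda>v. game_length E True (turn E v (D, B))) ` D) \<in>
      (\<lambda>v. game_length E True (turn E v (D, B))) ` D"
    using assms by (intro Max_in) auto
  then obtain v where "v \<in> D" "Max ((\<lambda>v. game_length E True (turn E v (D, B))) ` D)
      = game_length E True (turn E v (D, B))" by auto
  then show ?thesis using assms by (intro that[of v]) (auto simp: game_length.simps[of E False D])
qed

lemma game_length_attained:
  assumes "finite D" "D \<noteq> {}"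
  obtains v where "v \<in> D" "game_length E m (D, B) = 1 + game_length E (\<not> m) (turn E v (D, B))"
proof (cases m)
  case True
  then show ?thesis using game_length_Min_attained[OF assms, of E B] that by auto
next
  case False
  then show ?thesis using game_length_Max_attained[OF assms, of E B] that by auto
qed

text \<open>
  Each turn makes a vertex fire or lowers the number of brushes that are missing, and firing never
  increases this number.  This crude bound suffices once few brushes are missing.
\<close>

lemma game_length_le_missing:
  assumes "finite D"
  shows "game_length E m (D, B) \<le> card D + (\<Sum>u\<in>D. card (nbrs E D u) - B u)"
  using assms
proof (induction "card D + (\<Sum>u\<in>D. card (nbrs E D u) - B u)" arbitrary: D B m rule: less_induct)
  case less
  show ?case
  proof (cases "D = {}")
    case False
    obtain v where v: "v \<in> D" "game_length E m (D, B) = 1 + game_length E (\<not> m) (turn E v (D, B))"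
      using game_length_attained[OF less.prems False] .
    obtain D' B' where t: "turn E v (D, B) = (D', B')" by (cases "turn E v (D, B)")
    note sub = turn_fst_subset[OF less.prems t] and dec = turn_decreases[OF less.prems v(1) t]
    have "(\<Sum>u\<in>D'. card (nbrs E D' u) - B' u) \<le> (\<Sum>u\<in>D'. card (nbrs E D u) - B u)"
    proof (intro sum_mono)
      fix u assume u: "u \<in> D'"
      have "card (nbrs E D' u) \<le> card (nbrs E D u)" using less.prems sub by (rule card_nbrs_mono)
      moreover have "B u \<le> B' u" using turn_brushes[OF less.prems t u] by auto
      ultimately show "card (nbrs E D' u) - B' u \<le> card (nbrs E D u) - B u"
        by (rule diff_le_mono[THEN le_trans, OF _ diff_le_mono2])
    qed
    also have "\<dots> \<le> (\<Sum>u\<in>D. card (nbrs E D u) - B u)"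
      using less.prems sub by (intro sum_mono2) auto
    finally have "card D' + (\<Sum>u\<in>D'. card (nbrs E D' u) - B' u)
        < card D + (\<Sum>u\<in>D. card (nbrs E D u) - B u)"
      using dec by linarith
    from less.hyps[OF this finite_subset[OF sub less.prems], of "\<not> m"] this show ?thesis
      unfolding v(2) t by linarith
  qed simp
qed

section \<open>The predicted number of remaining turns\<close>

text \<open>
  The first integral \<open>A exp (r / A - 1)\<close> minus the \<open>r\<close> brushes already played: the number of turns
  that remain under the idealized play described above, when the degrees within the dirty set sum up to
  \<open>A\<close> and the dirty vertices carry \<open>r\<close> brushes.
\<close>

definition rest_value :: "real \<Rightarrow> real \<Rightarrow> real" where
  "rest_value A r = A * exp (r / A - 1) - r"

lemma rest_value_nonneg: "0 < A \<Longrightarrow> 0 \<le> rest_value A r"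
  using exp_ge_add_one_self[of "r / A - 1"] mult_left_mono[of "r / A" "exp (r / A - 1)" A]
  by (simp add: rest_value_def)

text \<open>
  The derivative in \<open>r\<close> is \<open>exp (r / A - 1) - 1\<close>, which is negative for \<open>r < A\<close>.
\<close>

lemma rest_value_antimono:
  assumes "0 < A" "r \<le> r'" "r' \<le> A"
  shows "rest_value A r' \<le> rest_value A r"
proof -
  let ?x = "exp (r' / A - 1)" and ?y = "(r' - r) / A"
  have "?x \<le> 1" using assms by simp
  have e: "exp (r / A - 1) = ?x * exp (- ?y)" 
    by (simp add: exp_add[symmetric] diff_divide_distrib)
  have "?x - ?x * exp (- ?y) = ?x * (1 - exp (- ?y))" by (simp add: algebra_simps)
  also have "\<dots> \<le> 1 * ?y"
    using exp_ge_add_one_self[of "- ?y"] assms \<open>?x \<le> 1\<close> by (intro mult_mono) auto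
  finally have "A * (?x - exp (r / A - 1)) \<le> A * ?y"
    unfolding e using assms(1) by (intro mult_left_mono) auto
  also have "A * ?y = r' - r" using assms(1) by simp
  finally show ?thesis by (simp add: rest_value_def right_diff_distrib)
qed

lemma rest_value_shift: "0 < A \<Longrightarrow> 0 \<le> c \<Longrightarrow> rest_value A (r - c) \<le> rest_value A r + c"
  by (simp add: rest_value_def divide_right_mono)

text \<open>
  Vertices that fire without losing brushes can only shorten the rest of the game.
\<close>

lemma rest_value_mono_left:
  assumes "0 < A'" "A' \<le> A" "r \<le> A'"
  shows "rest_value A' r \<le> rest_value A r"
proof -
  have "r / A' - r / A = r * ((A - A') / (A * A'))" using assms by (simp add: field_simps)
  also have "\<dots> \<le> A' * ((A - A') / (A * A'))" using assms by (intro mult_right_mono) auto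
  also have "\<dots> = 1 - A' / A" using assms by (simp add: field_simps)
  finally have "r / A' - 1 \<le> (r / A - 1) + (1 - A' / A)" by simp
  then have "exp (r / A' - 1) \<le> exp (r / A - 1) * exp (1 - A' / A)" by (simp flip: exp_add)
  moreover have "A' * exp (1 - A' / A) \<le> A"
  proof -
    have "A' / A \<le> exp (A' / A - 1)" using exp_ge_add_one_self[of "A' / A - 1"] by simp
    then have "A' / A * exp (1 - A' / A) \<le> exp (A' / A - 1) * exp (1 - A' / A)"
      by (intro mult_right_mono) auto
    then have "A' / A * exp (1 - A' / A) \<le> 1" by (simp flip: exp_add)
    then show ?thesis using assms by (simp add: pos_divide_le_eq mult.commute)
  qed
  ultimately have "exp (r / A - 1) * (A' * exp (1 - A' / A)) \<le> exp (r / A - 1) * A"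
    and "A' * exp (r / A' - 1) \<le> A' * (exp (r / A - 1) * exp (1 - A' / A))"
    using assms by (auto intro: mult_left_mono)
  then have "A' * exp (r / A' - 1) \<le> A * exp (r / A - 1)" by (simp only: ac_simps)
  then show ?thesis by (simp add: rest_value_def)
qed

text \<open>
  A cascade of \<open>k\<close> vertices may lose \<open>p k\<^sup>2\<close> brushes.  The difference of the two sides is compared in
  two ranges of \<open>r\<close>.  Where it is increasing in \<open>r\<close>, it is at most its value at the largest \<open>r\<close>
  allowed, for which no turn remains after the cascade, and there the claim is the nonnegativity of
  \<open>rest_value\<close>.  For smaller \<open>r\<close> the exponential factor only shrinks in the cascade, and the loss
  \<open>p k\<^sup>2\<close> is at most the decrease of \<open>A / e\<close>, because \<open>k \<le> m / 2\<close> and \<open>e \<le> 3\<close>.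
\<close>

lemma rest_value_avalanche:
  fixes p m k r :: real
  assumes "0 < p" "0 < m" "0 \<le> k" "k \<le> m / 2" "0 \<le> r" "r - p * k\<^sup>2 \<le> p * (m - k)\<^sup>2"
  shows "rest_value (p * (m - k)\<^sup>2) (r - p * k\<^sup>2) \<le> rest_value (p * m\<^sup>2) r"
proof -
  define A A' a where "A = p * m\<^sup>2" and "A' = p * (m - k)\<^sup>2" and "a = p * k\<^sup>2"
  have pos: "0 < A" "0 < A'" "0 \<le> a" using assms by (auto simp: A_def A'_def a_def)
  have AA': "A - A' = p * (2 * m * k - k\<^sup>2)"
    by (simp add: A_def A'_def power2_eq_square algebra_simps)
  have k3: "3 * k\<^sup>2 \<le> 2 * m * k - k\<^sup>2"
    using mult_right_mono[of "2 * k" m k] assms by (simp add: power2_eq_square algebra_simps)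
  have a3: "3 * a \<le> A - A'"
    using mult_left_mono[OF k3, of p] assms(1) unfolding AA' a_def by (simp add: mult.left_commute)
  then have le: "A' \<le> A" using pos by simp
  define h where "h = (\<lambda>s. A' * exp ((s - a) / A' - 1) + a - A * exp (s / A - 1))"
  have "h r \<le> 0"
  proof (cases "(r - a) / A' \<le> r / A")
    case True
    have "h r \<le> A' * exp (r / A - 1) + a - A * exp (r / A - 1)"
      using True pos by (simp add: h_def)
    also have "\<dots> = a - (A - A') * exp (r / A - 1)" by (simp add: algebra_simps)
    also have "\<dots> \<le> a - (3 * a) * exp (- 1)"
      using a3 pos assms(5) by (intro diff_left_mono mult_mono) auto
    also have "\<dots> \<le> 0"
      using exp_le pos mult_left_mono[of "exp 1" 3 a] by (simp add: exp_minus field_simps)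
    finally show ?thesis .
  next
    case False
    have "h r \<le> h (A' + a)"
    proof (rule DERIV_nonneg_imp_nondecreasing[where f = h])
      show "r \<le> A' + a" using assms(6) by (simp add: A'_def a_def)
      fix s assume s: "r \<le> s" "s \<le> A' + a"
      have "(h has_real_derivative exp ((s - a) / A' - 1) - exp (s / A - 1)) (at s)"
        unfolding h_def using pos by (auto intro!: derivative_eq_intros)
      moreover have "s / A \<le> (s - a) / A'"
      proof -
        have "(s - r) / A \<le> (s - r) / A'" using s le pos by (intro divide_left_mono) auto
        then show ?thesis using False by (simp add: diff_divide_distrib)
      qed
      ultimately show "\<exists>y. (h has_real_derivative y) (at s) \<and> 0 \<le> y" by force
    qed
    also have "h (A' + a) = (A' + a) - A * exp ((A' + a) / A - 1)" using pos by (simp add: h_def)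
    also have "\<dots> \<le> 0" using rest_value_nonneg[OF pos(1), of "A' + a"] by (simp add: rest_value_def)
    finally show ?thesis .
  qed
  then have "rest_value A' (r - a) \<le> rest_value A r" by (simp add: rest_value_def h_def)
  then show ?thesis by (simp only: A_def A'_def a_def)
qed

text \<open>
  One step of the discretized motion: \<open>b\<close> brushes are played, at most twice the average number
  missing plus an error, and one vertex fires.  To first order in \<open>1 / m\<close> the exponent of
  \<open>A exp (r / A - 1)\<close> rises by \<open>2 / m\<close>, which cancels against the factor
  \<open>(1 - 1 / m)\<^sup>2\<close> by which \<open>A\<close> shrinks.
\<close>

lemma rest_value_phase:
  fixes p m r e b :: real
  assumes "0 < p" "4 \<le> m" "0 \<le> r" "r \<le> 2 * p * m\<^sup>2" "0 \<le> e" "8 * e \<le> p * m\<^sup>2"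
    and b: "b \<le> 2 * ((p * m\<^sup>2 - r) / m) + 2 * e"
  shows "rest_value (p * (m - 1)\<^sup>2) (r + b) + b \<le> rest_value (p * m\<^sup>2) r + 48 * p + 24 * e"
proof -
  define A A' where "A = p * m\<^sup>2" and "A' = p * (m - 1)\<^sup>2"
  have pos: "0 < A" "0 < A'" using assms by (auto simp: A_def A'_def)
  define y where "y = 4 / (m - 1)\<^sup>2 + 2 * e / A'"
  have half: "m\<^sup>2 \<le> 2 * (m - 1)\<^sup>2"
  proof -
    have "0 \<le> (m - 4) * m + 2" using assms(2) by simp
    then show ?thesis by (simp add: power2_eq_square algebra_simps)
  qed
  have AA: "A \<le> 2 * A'" using mult_left_mono[OF half, of p] assms(1) by (simp add: A_def A'_def)
  have y: "y \<le> 8 / m\<^sup>2 + 4 * e / A"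
  proof -
    have "4 / (m - 1)\<^sup>2 \<le> 8 / m\<^sup>2" using half assms(2) by (simp add: field_simps)
    moreover have "2 * e / A' \<le> 4 * e / A"
      using mult_left_mono[OF AA assms(5)] pos by (simp add: field_simps)
    ultimately show ?thesis by (simp add: y_def)
  qed
  have "16 \<le> m\<^sup>2" using power_mono[OF assms(2), of 2] by simp
  then have "8 / m\<^sup>2 \<le> 8 / 16" by (intro divide_left_mono) auto
  moreover have "4 * e / A \<le> 1 / 2" using assms(6) pos by (simp add: A_def field_simps)
  ultimately have y1: "y \<le> 1" using y by simp
  have y0: "0 \<le> y" using assms pos by (simp add: y_def)
  have expo: "(r + b) / A' \<le> r / A + 2 / m + y"
  proof -
    have "(r + b) / A' \<le> (r + 2 * ((A - r) / m) + 2 * e) / A'"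
      using b pos by (intro divide_right_mono) (auto simp: A_def)
    also have "\<dots> = r / A + (r * (A - A') / (A * A') + 2 * ((A - r) / m) / A') + 2 * e / A'"
    proof -
      have "r / A' = r / A + r * (A - A') / (A * A')" using pos by (simp add: field_simps)
      then show ?thesis by (simp add: add_divide_distrib)
    qed
    also have "r * (A - A') / (A * A') + 2 * ((A - r) / m) / A' \<le> 2 * m / (m - 1)\<^sup>2"
    proof -
      have "A - A' \<le> 2 * p * m"
        using assms(1) by (simp add: A_def A'_def power2_eq_square algebra_simps)
      then have "r * (A - A') / (A * A') \<le> r * (2 * p * m) / (A * A')"
        using pos assms(3) by (intro divide_right_mono mult_left_mono) auto
      also have "\<dots> = 2 * r / m / A'" using assms(1,2) by (simp add: A_def power2_eq_square)
      finally have "r * (A - A') / (A * A') + 2 * ((A - r) / m) / A' \<le>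
          2 * r / m / A' + 2 * ((A - r) / m) / A'" by simp
      also have "\<dots> = 2 * A / m / A'" by (simp add: diff_divide_distrib)
      also have "\<dots> = 2 * m / (m - 1)\<^sup>2"
        using assms(1,2) by (simp add: A_def A'_def power2_eq_square)
      finally show ?thesis .
    qed
    also have "2 * m / (m - 1)\<^sup>2 \<le> 2 / m + 4 / (m - 1)\<^sup>2"
    proof -
      have "2 * m * m \<le> 2 * (m - 1)\<^sup>2 + 4 * m" by (simp add: power2_eq_square algebra_simps)
      then have "2 * m * m / (m * (m - 1)\<^sup>2) \<le> (2 * (m - 1)\<^sup>2 + 4 * m) / (m * (m - 1)\<^sup>2)"
        using assms(2) by (intro divide_right_mono) auto
      then show ?thesis using assms(2) by (simp add: add_divide_distrib)
    qed
    finally show ?thesis by (simp add: y_def)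
  qed
  have "A' \<le> A * exp (- 2 / m)"
  proof -
    have "1 - 1 / m \<le> exp (- 1 / m)" using exp_ge_add_one_self[of "- 1 / m"] by simp
    then have "(1 - 1 / m)\<^sup>2 \<le> (exp (- 1 / m))\<^sup>2" using assms(2) by (intro power_mono) auto
    also have "\<dots> = exp (- 2 / m)" by (simp add: power2_eq_square flip: exp_add)
    finally have "A * (1 - 1 / m)\<^sup>2 \<le> A * exp (- 2 / m)" using pos by (intro mult_left_mono) auto
    moreover have "A * (1 - 1 / m)\<^sup>2 = A'"
      using assms(2) by (simp add: A_def A'_def power2_eq_square field_simps)
    ultimately show ?thesis by simp
  qed
  then have "A' * exp ((r + b) / A' - 1) \<le> A * exp (- 2 / m) * exp (r / A + 2 / m + y - 1)"
    using expo pos by (intro mult_mono) auto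
  also have "\<dots> = A * exp (r / A - 1) * exp y"
    by (simp add: mult.assoc flip: exp_add)
  also have "\<dots> \<le> A * exp (r / A - 1) * (1 + 2 * y)"
  proof -
    have "y\<^sup>2 \<le> y" using mult_left_mono[OF y1 y0] by (simp add: power2_eq_square)
    then have "exp y \<le> 1 + 2 * y" using exp_bound[OF y0 y1] by simp
    then show ?thesis using pos by (intro mult_left_mono) auto
  qed
  also have "\<dots> = A * exp (r / A - 1) + A * exp (r / A - 1) * (2 * y)" by (simp add: algebra_simps)
  also have "A * exp (r / A - 1) * (2 * y) \<le> A * 3 * (2 * (8 / m\<^sup>2 + 4 * e / A))"
  proof -
    have "exp (r / A - 1) \<le> exp 1" using assms(4) pos by (simp add: A_def field_simps)
    then have "exp (r / A - 1) \<le> 3" using exp_le by (rule order_trans)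
    then show ?thesis using y y0 pos by (intro mult_mono) auto
  qed
  also have "\<dots> = 48 * p + 24 * e"
  proof -
    have "A * (8 / m\<^sup>2) = 8 * p" using assms(2) by (simp add: A_def)
    moreover have "A * (4 * e / A) = 4 * e" using pos by simp
    moreover have "A * 3 * (2 * (x + z)) = 6 * (A * x) + 6 * (A * z)" for x z :: real
      by (simp add: algebra_simps)
    ultimately show ?thesis by (simp only:)
  qed
  finally have "rest_value A' (r + b) + b \<le> rest_value A r + 48 * p + 24 * e" by (simp add: rest_value_def)
  then show ?thesis by (simp only: A_def A'_def)
qed

section \<open>Upper bound: Min completes one vertex at a time\<close>

definition brushes :: "'a set \<Rightarrow> ('a \<Rightarrow> nat) \<Rightarrow> nat" where
  "brushes D B = (\<Sum>u\<in>D. B u)"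

text \<open>
  Clean neighbours have sent one brush each.  This lower bound on the brushes ends the game soon after
  half of the vertices have fired.
\<close>

definition received :: "'a set set \<Rightarrow> 'a set \<Rightarrow> 'a set \<Rightarrow> ('a \<Rightarrow> nat) \<Rightarrow> bool" where
  "received E V D B \<longleftrightarrow> (\<forall>u\<in>D. card (nbrs E (V - D) u) \<le> B u)"

lemma turn_received:
  assumes "finite V" "D \<subseteq> V" "received E V D B" "turn E v (D, B) = (D', B')"
  shows "received E V D' B'"
  unfolding received_def
proof
  fix u assume u: "u \<in> D'"
  have fin: "finite D" using assms finite_subset by blast
  note sub = turn_fst_subset[OF fin assms(4)]
  have "V - D' = (V - D) \<union> (D - D')" using sub assms(2) by auto
  then have "card (nbrs E (V - D') u) = card (nbrs E (V - D) u) + card (nbrs E (D - D') u)"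
    using assms(1) fin by (simp only:) (subst card_nbrs_Un, auto)
  also have "\<dots> \<le> B u + card (nbrs E (D - D') u)"
    using assms(3) u sub by (auto simp: received_def)
  also have "\<dots> \<le> B' u" using turn_brushes[OF fin assms(4) u] by simp
  finally show "card (nbrs E (V - D') u) \<le> B' u" .
qed

text \<open>
  In a stable position no vertex carries more brushes than it has dirty neighbours, so a vertex that
  fires in the turn loses at most the brushes for its neighbours that fire in the same turn.
\<close>

lemma turn_brushes_ge:
  assumes "stable E D B" "v \<in> D" "turn E v (D, B) = (D', B')"
  shows "brushes D B + 1 \<le> brushes D' B' + edge_count E (D - D') (D - D')"
proof -
  have fin: "finite D" using assms(1) by (simp add: stable_def)
  note sub = turn_fst_subset[OF fin assms(3)]
  let ?X = "D - D'" and ?B = "B(v := B v + 1)"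
  have fin': "finite D'" "finite ?X" using fin sub finite_subset by auto
  have D: "D = D' \<union> ?X" using sub by auto
  have "brushes D B + 1 = (\<Sum>u\<in>D. ?B u)"
    using assms(2) fin by (simp add: brushes_def sum.remove[of D v])
  also have "\<dots> = (\<Sum>u\<in>D'. ?B u) + (\<Sum>u\<in>?X. ?B u)"
    using fin sub by (subst D, subst sum.union_disjoint) (auto simp: finite_subset)
  also have "(\<Sum>u\<in>?X. ?B u) \<le> (\<Sum>u\<in>?X. card (nbrs E D u))"
    using assms(1) by (intro sum_mono) (force simp: stable_def Suc_le_eq)
  also have "(\<Sum>u\<in>?X. card (nbrs E D u)) = edge_count E ?X D' + edge_count E ?X ?X"
    unfolding edge_count_def[symmetric] using fin' by (subst D, subst edge_count_Un_right) auto
  also have "edge_count E ?X D' = (\<Sum>u\<in>D'. card (nbrs E ?X u))"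
    unfolding edge_count_commute[OF fin'(2,1)] by (simp add: edge_count_def)
  also have "(\<Sum>u\<in>D'. ?B u) + ((\<Sum>u\<in>D'. card (nbrs E ?X u)) + edge_count E ?X ?X)
     = brushes D' B' + edge_count E ?X ?X"
    unfolding brushes_def using turn_brushes[OF fin assms(3)] by (simp add: sum.distrib)
  finally show ?thesis by simp
qed

lemma turn_target:
  assumes "finite D" "turn E w (D, B) = (D, B')" "v \<in> D"
  shows "card (nbrs E D v) - B' v \<le> card (nbrs E D v) - B v"
    and "w = v \<Longrightarrow> B' v = B v + 1"
  using turn_no_fire[OF assms(1,2)] by auto

text \<open>
  Min keeps feeding \<open>v\<close>.  If nothing else fires before, \<open>v\<close> fires after at most as many turns of
  Min as it lacks brushes; every turn of Min is followed by at most one turn of Max.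
\<close>

lemma min_phase:
  assumes "finite V" "D \<subseteq> V" "stable E D B" "received E V D B" "v \<in> D"
  shows "\<exists>D' B' k. D' \<subset> D \<and> stable E D' B' \<and> received E V D' B' \<and>
    k \<le> 2 * (card (nbrs E D v) - B v) \<and>
    brushes D B + k \<le> brushes D' B' + edge_count E (D - D') (D - D') \<and>
    game_length E True (D, B) \<le> k + game_length E True (D', B')"
  using assms
proof (induction "card (nbrs E D v) - B v" arbitrary: B rule: less_induct)
  case less
  have fin: "finite D" using less.prems by (simp add: stable_def)
  have pos: "1 \<le> card (nbrs E D v) - B v" using less.prems by (force simp: stable_def)
  obtain D1 B1 where t1: "turn E v (D, B) = (D1, B1)" by (cases "turn E v (D, B)")
  have gl1: "game_length E True (D, B) \<le> 1 + game_length E False (D1, B1)"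
    using game_length_Min_le[OF fin less.prems(5), of E B] t1 by simp
  note sub1 = turn_fst_subset[OF fin t1] and st1 = turn_stable[OF fin t1]
    and rec1 = turn_received[OF less.prems(1,2,4) t1]
    and br1 = turn_brushes_ge[OF less.prems(3,5) t1]
  show ?case
  proof (cases "D1 = {}")
    case True
    then show ?thesis using gl1 sub1 st1 rec1 br1 pos less.prems(5)
      by (intro exI[of _ D1] exI[of _ B1] exI[of _ 1]) auto
  next
    case False
    have fin1: "finite D1" using st1 by (simp add: stable_def)
    obtain w where w: "w \<in> D1"
      and gl2: "game_length E False (D1, B1) = 1 + game_length E True (turn E w (D1, B1))"
      using game_length_Max_attained[OF fin1 False] .
    obtain D2 B2 where t2: "turn E w (D1, B1) = (D2, B2)" by (cases "turn E w (D1, B1)")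
    have "D1 \<subseteq> V" using sub1 less.prems by auto
    note sub2 = turn_fst_subset[OF fin1 t2] and st2 = turn_stable[OF fin1 t2]
      and rec2 = turn_received[OF less.prems(1) \<open>D1 \<subseteq> V\<close> rec1 t2]
      and br2 = turn_brushes_ge[OF st1 w t2]
    have "edge_count E (D - D1) (D - D1) + edge_count E (D1 - D2) (D1 - D2) \<le>
        edge_count E ((D - D1) \<union> (D1 - D2)) ((D - D1) \<union> (D1 - D2))"
      using fin fin1 by (intro edge_count_superadditive) auto
    also have "(D - D1) \<union> (D1 - D2) = D - D2" using sub1 sub2 by auto
    finally have br: "brushes D B + 2 \<le> brushes D2 B2 + edge_count E (D - D2) (D - D2)"
      using br1 br2 by simp
    have gl: "game_length E True (D, B) \<le> 2 + game_length E True (D2, B2)"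
      using gl1 gl2 t2 by simp
    show ?thesis
    proof (cases "D2 = D")
      case False
      then show ?thesis using gl br sub1 sub2 st2 rec2 pos
        by (intro exI[of _ D2] exI[of _ B2] exI[of _ 2]) auto
    next
      case True
      then have eq: "D1 = D" using sub1 sub2 by auto
      have "B1 v = B v + 1" using turn_target(2)[OF fin t1[unfolded eq] less.prems(5)] by simp
      moreover have "card (nbrs E D v) - B2 v \<le> card (nbrs E D v) - B1 v"
        using turn_target(1)[OF fin t2[unfolded eq True] less.prems(5)] .
      ultimately have dec: "card (nbrs E D v) - B2 v + 1 \<le> card (nbrs E D v) - B v"
        using pos by linarith
      then have "card (nbrs E D v) - B2 v < card (nbrs E D v) - B v" by linarith
      from less.hyps[OF this less.prems(1,2) st2[unfolded True] rec2[unfolded True] less.prems(5)]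
      obtain D' B' k where *: "D' \<subset> D" "stable E D' B'" "received E V D' B'"
        "k \<le> 2 * (card (nbrs E D v) - B2 v)"
        "brushes D B2 + k \<le> brushes D' B' + edge_count E (D - D') (D - D')"
        "game_length E True (D, B2) \<le> k + game_length E True (D', B')" by blast
      have "edge_count E (D - D2) (D - D2) = 0" using True by (simp add: edge_count_def)
      then show ?thesis using * gl br dec True
        by (intro exI[of _ D'] exI[of _ B'] exI[of _ "k + 2"]) auto
    qed
  qed
qed

lemma game_length_stable_le:
  assumes "stable E D B"
  shows "real (game_length E m (D, B)) \<le> card D + edge_count E D D - real (brushes D B)"
proof -
  have fin: "finite D" using assms by (simp add: stable_def)
  have "(\<Sum>u\<in>D. card (nbrs E D u) - B u) + brushes D B = edge_count E D D"
    unfolding brushes_def edge_count_def sum.distrib[symmetric]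
    using assms by (intro sum.cong) (auto simp: stable_def)
  then show ?thesis using game_length_le_missing[OF fin, of E m B] by linarith
qed

text \<open>
  The precision is governed by \<open>K\<close>: the density is exact up to \<open>1 / K\<^sup>2\<close>, while the length of the
  game will be determined up to order \<open>1 / K\<close>, since the density is used on about \<open>K\<close> blocks
  of \<open>n / K\<close> vertices.
\<close>

locale pseudorandom =
  fixes n K :: nat and p :: real and E :: "nat set set"
  assumes p: "0 < p" "p \<le> 1"
    and K: "4 \<le> K" "K\<^sup>2 \<le> n" "K \<le> p * n"
    and dens: "\<And>S T. S \<subseteq> {1..n} \<Longrightarrow> T \<subseteq> {1..n} \<Longrightarrow>
      \<bar>real (edge_count E S T) - p * card S * card T\<bar> \<le> p * n\<^sup>2 / K\<^sup>2"
begin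

abbreviation V :: "nat set" where "V \<equiv> {1..n}"

definition \<eta> :: real where "\<eta> = p * n\<^sup>2 / K\<^sup>2"

lemma \<eta>_bounds: "0 < \<eta>" "p * n \<le> \<eta>" "p * n \<le> n" "real n \<le> K * \<eta>"
proof -
  have k: "0 < real K" "0 < real n" "real K ^ 2 \<le> n"
    using K by (auto intro: Nat.gr0I simp flip: of_nat_power)
  show "0 < \<eta>" using p k by (simp add: \<eta>_def)
  have "p * n * (real K)\<^sup>2 \<le> p * n * n" using p k by (intro mult_left_mono) auto
  then show "p * n \<le> \<eta>" using k by (simp add: \<eta>_def field_simps power2_eq_square)
  have "K * real n \<le> (p * n) * n" using K k by (intro mult_right_mono) auto
  also have "\<dots> = K\<^sup>2 * \<eta>" using k by (simp add: \<eta>_def power2_eq_square)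
  finally have "K * real n \<le> K\<^sup>2 * \<eta>" .
  then show "real n \<le> K * \<eta>" using k by (simp add: power2_eq_square)
  show "p * n \<le> n" using p k by simp
qed

lemma card_V_le: "S \<subseteq> V \<Longrightarrow> card S \<le> n"
  using card_mono[of V S] by simp

lemma edge_count_bounds:
  assumes "S \<subseteq> V" "T \<subseteq> V"
  shows "edge_count E S T \<le> p * card S * card T + \<eta>" "p * card S * card T - \<eta> \<le> edge_count E S T"
  using dens[OF assms] by (auto simp: \<eta>_def)

lemma edge_count_self_le:
  assumes "S \<subseteq> V" shows "edge_count E S S \<le> p * (real (card S))\<^sup>2 + \<eta>"
  using edge_count_bounds(1)[OF assms assms] by (simp add: power2_eq_square)

lemma edge_count_small:
  assumes "S \<subseteq> V" "K * card S < n"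
  shows "edge_count E S S \<le> 2 * \<eta>"
proof -
  have "real (K * card S) \<le> real n" using assms(2) by (intro of_nat_mono) simp
  then have "(real (K * card S))\<^sup>2 \<le> (real n)\<^sup>2" by (intro power_mono) auto
  then have "p * (real (card S))\<^sup>2 \<le> \<eta>"
    using K p by (simp add: \<eta>_def power_mult_distrib field_simps)
  then show ?thesis using edge_count_self_le[OF assms(1)] by simp
qed

text \<open>
  At most half of the vertices are dirty.  On average and up to the error in the density, a dirty vertex
  then has at least as many clean neighbours as dirty ones, and each clean neighbour has sent it a brush.
\<close>

lemma game_length_small:
  assumes "D \<subseteq> V" "stable E D B" "received E V D B" "2 * card D \<le> n"
  shows "game_length E m (D, B) \<le> n + 2 * \<eta>"
proof -
  have "edge_count E D (V - D) \<le> brushes D B"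
    unfolding edge_count_def brushes_def using assms(3) by (intro sum_mono) (auto simp: received_def)
  moreover have "p * card D * card (V - D) - \<eta> \<le> edge_count E D (V - D)"
    using assms(1) by (intro edge_count_bounds) auto
  moreover have "p * card D * card D \<le> p * card D * card (V - D)"
    using assms(1,4) p finite_subset[OF assms(1)]
    by (intro mult_left_mono) (auto simp: card_Diff_subset)
  ultimately show ?thesis
    using edge_count_bounds(1)[OF assms(1,1)] game_length_stable_le[OF assms(2), of m]
      card_V_le[OF assms(1)] by linarith
qed

text \<open>
  The brushes lost in cascades are estimated by edges inside the set of fired vertices, with an error
  \<open>\<eta>\<close> each time.  To use this estimate only about \<open>K\<close> times, losses are collected relative to
  an earlier dirty set \<open>D0\<close>: the number \<open>r\<close>, which stands for the brushes on \<open>D\<close>, may exceed their true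
  number by the edges among the vertices that fired since \<open>D0\<close> was the dirty set, because these edges
  bound the loss.  As soon as \<open>n / K\<close> vertices have fired since then, \<open>D0\<close> is replaced
  by the present dirty set.  The error terms linear in \<open>card D\<close> and \<open>card D0\<close> pay for the phases and for
  these replacements.
\<close>

lemma upper_bound_induction:
  assumes "stable E D B" "D \<noteq> {}" "D \<subseteq> D0" "D0 \<subseteq> V" "K * card (D0 - D) < n" "received E V D B"
    and "0 \<le> r" "r \<le> real (brushes D B) + edge_count E (D0 - D) (D0 - D)"
  shows "game_length E True (D, B) \<le> rest_value (p * (real (card D))\<^sup>2) r
    + n + 7 * \<eta> + (200 * \<eta> / n) * card D + (5 * K * \<eta> / n) * card D0"
  using assms
proof (induction "card D" arbitrary: D B D0 r rule: less_induct)
  case less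
  note [simp] = \<eta>_bounds(1)[THEN less_imp_le]
  define m where "m = real (card D)"
  have n0: "0 < real n" using K by (auto intro: Nat.gr0I)
  have fin: "finite D" and DV: "D \<subseteq> V" using less.prems finite_subset by (auto simp: stable_def)
  have m1: "1 \<le> m" using less.prems(2) fin by (simp add: m_def Suc_le_eq card_gt_0_iff)
  have mn: "m \<le> n" using card_V_le[OF DV] by (simp add: m_def)
  have err: "0 \<le> (200 * \<eta> / n) * c" "0 \<le> (5 * K * \<eta> / n) * c" if "0 \<le> c" for c
    using that n0 by auto
  show ?case
  proof (cases "2 * card D \<le> n")
    case True
    have "0 \<le> rest_value (p * m\<^sup>2) r" using p m1 by (intro rest_value_nonneg) auto
    then show ?thesis using game_length_small[OF DV less.prems(1,6) True, of True] 
        err(1)[of m] err(2)[of "card D0"] m1 \<eta>_bounds(1) unfolding m_def[symmetric] by linarith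
  next
    case False
    then have big: "n < 2 * m" by (simp add: m_def)
    define d where "d = (\<lambda>u. card (nbrs E D u) - B u)"
    obtain v where v: "v \<in> D" "\<And>u. u \<in> D \<Longrightarrow> d v \<le> d u"
      using ex_min_if_finite[of "d ` D"] fin less.prems(2)
      by (metis (no_types, lifting) arg_min_if_finite(1) arg_min_least)
    obtain D' B' k where D': "D' \<subset> D" "stable E D' B'" "received E V D' B'" "k \<le> 2 * d v"
      "brushes D B + k \<le> brushes D' B' + edge_count E (D - D') (D - D')"
      "game_length E True (D, B) \<le> k + game_length E True (D', B')"
      using min_phase[OF _ DV less.prems(1,6) v(1)] unfolding d_def by auto
    define m' where "m' = real (card D')"
    have m'0: "0 \<le> m'" by (simp add: m'_def)
    have D'V: "D' \<subseteq> V" and fin': "finite D'" using D' DV fin finite_subset by (auto simp: stable_def)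
    have card': "card D' < card D" using D'(1) fin by (simp add: psubset_card_mono)
    then have m'm: "m' \<le> m - 1" by (simp add: m_def m'_def)
    have X: "real (card (D - D')) = m - m'" 
      using D'(1) fin' fin by (simp add: card_Diff_subset m_def m'_def less_imp_le card_mono of_nat_diff)
    have anchor: "edge_count E (D0 - D) (D0 - D) \<le> 2 * \<eta>"
      using less.prems(4,5) by (intro edge_count_small) auto
    have "m * d v \<le> edge_count E D D - real (brushes D B)"
    proof -
      have "card D * d v \<le> (\<Sum>u\<in>D. d u)" using v(2) sum_bounded_below[of D "d v" d] by simp
      moreover have "(\<Sum>u\<in>D. d u) + brushes D B = edge_count E D D"
        unfolding brushes_def edge_count_def sum.distrib[symmetric] d_def
        using less.prems(1) by (intro sum.cong) (auto simp: stable_def)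
      ultimately have "card D * d v + brushes D B \<le> edge_count E D D" by simp
      then show ?thesis unfolding m_def by (simp flip: of_nat_mult of_nat_add)
    qed
    also have "\<dots> \<le> p * m\<^sup>2 - r + 3 * \<eta>"
      using edge_count_self_le[OF DV] less.prems(8) anchor by (simp add: m_def)
    finally have dv: "d v \<le> (p * m\<^sup>2 - r) / m + 3 * \<eta> / m"
      using m1 by (simp add: field_simps)
    \<comment> \<open>Replacing the actual numbers of edges by \<open>p m\<^sup>2\<close> and undoing the losses since \<open>D0\<close> costs
      \<open>3 \<eta> / m\<close> per vertex.\<close>
    define e where "e = 6 * \<eta> / n"
    have "3 * \<eta> / m \<le> 3 * \<eta> / (n / 2)" using big n0 by (intro divide_left_mono) auto
    then have "3 * \<eta> / m \<le> e" by (simp add: e_def)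
    then have dv': "real k \<le> 2 * ((p * m\<^sup>2 - r) / m) + 2 * e" using dv D'(4) by linarith
    have K16: "16 \<le> (real K)\<^sup>2" "(real K)\<^sup>2 \<le> n"
      using K power_mono[of 4 "real K" 2] by (auto simp flip: of_nat_power)
    have n16: "16 \<le> real n" using order_trans[OF K16] .
    have n4: "(real n)\<^sup>2 \<le> 4 * m\<^sup>2" using power_mono[of "real n" "2 * m" 2] big n0
      by (simp add: power_mult_distrib)
    have "16 * \<eta> \<le> (real K)\<^sup>2 * \<eta>" using K16 by (intro mult_right_mono) auto
    also have "\<dots> = p * (real n)\<^sup>2" using K by (simp add: \<eta>_def)
    also have "p * (real n)\<^sup>2 \<le> p * (4 * m\<^sup>2)" using n4 p by (intro mult_left_mono) auto
    finally have eta4: "4 * \<eta> \<le> p * m\<^sup>2" by simp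
    have step: "rest_value (p * (m - 1)\<^sup>2) (r + k) + k \<le> rest_value (p * m\<^sup>2) r + 48 * p + 24 * e"
    proof (rule rest_value_phase[OF p(1) _ less.prems(7) _ _ _ dv'])
      show "4 \<le> m" using big K16 by linarith
      have "real (brushes D B) \<le> edge_count E D D"
        using less.prems(1) unfolding brushes_def edge_count_def
        by (auto intro!: sum_mono simp: stable_def less_imp_le simp flip: of_nat_sum)
      then show "r \<le> 2 * p * m\<^sup>2"
        using edge_count_self_le[OF DV] less.prems(8) anchor eta4 by (simp add: m_def)
      show "0 \<le> e" using n0 by (simp add: e_def)
      have "8 * e = 48 * \<eta> / n" by (simp add: e_def)
      also have "\<dots> \<le> 48 * \<eta> / 16"
        using order_trans[OF K16] n0 by (intro divide_left_mono) auto
      finally have "8 * e \<le> 3 * \<eta>" by simp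
      then show "8 * e \<le> p * m\<^sup>2" using eta4 \<eta>_bounds(1) by linarith
    qed
    have e_le: "48 * p + 24 * e \<le> 200 * \<eta> / n"
    proof -
      have "p \<le> \<eta> / n" using \<eta>_bounds(2) n0 by (simp add: field_simps)
      moreover have "0 \<le> \<eta> / n" using n0 by simp
      moreover have "e = 6 * (\<eta> / n)" "200 * \<eta> / n = 200 * (\<eta> / n)" by (simp_all add: e_def)
      ultimately show ?thesis by linarith
    qed
    have step: "rest_value (p * (m - 1)\<^sup>2) (r + k) + k \<le> rest_value (p * m\<^sup>2) r + 200 * \<eta> / n"
      using step e_le by linarith
    have mpos: "0 < p * (m - 1)\<^sup>2" using p big n16 by auto
    have target: "game_length E True (D', B') \<le> rest_value (p * (m - 1)\<^sup>2) (r + k)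
      + n + 7 * \<eta> + (200 * \<eta> / n) * (m - 1) + (5 * K * \<eta> / n) * card D0"
    proof -
      have crude: ?thesis if "game_length E True (D', B') \<le> n + 7 * \<eta>"
        using that rest_value_nonneg[OF mpos, of "r + k"] err(1)[of "m - 1"] err(2)[of "card D0"] m1
        by linarith
      \<comment> \<open>The game is almost over, or \<open>D0\<close> can be kept, or it has to be replaced by \<open>D'\<close>.\<close>
      consider "2 * card D' \<le> n" | "n < 2 * m'" "K * card (D0 - D') < n"
        | "n < 2 * m'" "n \<le> K * card (D0 - D')" 
        unfolding m'_def by linarith
      then show ?thesis
      proof cases
        case 1
        then show ?thesis using game_length_small[OF D'V D'(2,3) 1, of True] \<eta>_bounds(1)
          by (intro crude) linarith
      next
        case 2
        have D0: "D0 - D' = (D0 - D) \<union> (D - D')" using D'(1) less.prems(3) by auto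
        have "edge_count E (D0 - D) (D0 - D) + edge_count E (D - D') (D - D')
            \<le> edge_count E (D0 - D') (D0 - D')"
          unfolding D0 using less.prems(4) fin 
          by (intro edge_count_superadditive) (auto intro: finite_subset)
        then have r': "r + k \<le> real (brushes D' B') + edge_count E (D0 - D') (D0 - D')"
          using less.prems(8) D'(5) by linarith
        have ne: "D' \<noteq> {}" using 2 n0 by (auto simp: m'_def)
        show ?thesis
        proof (cases "r + k \<le> p * m'\<^sup>2")
          case True
          have "game_length E True (D', B') \<le> rest_value (p * m'\<^sup>2) (r + k)
            + n + 7 * \<eta> + (200 * \<eta> / n) * m' + (5 * K * \<eta> / n) * card D0"
            unfolding m'_def
            using less.hyps[OF card' D'(2) ne _ less.prems(4) 2(2) D'(3) _ r'] D'(1) less.prems by auto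
          moreover have "rest_value (p * m'\<^sup>2) (r + k) \<le> rest_value (p * (m - 1)\<^sup>2) (r + k)"
            using p 2 n0 m'm True by (intro rest_value_mono_left) (auto intro!: power_mono)
          moreover have "(200 * \<eta> / n) * m' \<le> (200 * \<eta> / n) * (m - 1)"
            using n0 m'm by (intro mult_left_mono) auto
          ultimately show ?thesis by linarith
        next
          case False
          have "edge_count E (D0 - D') (D0 - D') \<le> 2 * \<eta>"
            using less.prems(4) 2 by (intro edge_count_small) auto
          then show ?thesis
            using game_length_stable_le[OF D'(2), of True] edge_count_self_le[OF D'V] r' False
              of_nat_mono[OF card_V_le[OF D'V], where 'a = real] \<eta>_bounds(1)
            unfolding m'_def by (intro crude) linarith
        qed
      next
        case 3
        \<comment> \<open>The vertex that fires first loses no brushes and has been accounted for in \<open>step\<close>; the other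
          \<open>j\<close> vertices form the cascade.\<close>
        define j where "j = m - 1 - m'"
        have j: "0 \<le> j" "j \<le> (m - 1) / 2" "m - 1 - j = m'" "m - m' = j + 1" "j \<le> n"
          using m'm mn 3(1) m'0 by (auto simp: j_def)
        have "edge_count E (D - D') (D - D') \<le> p * (j + 1)\<^sup>2 + \<eta>"
          using edge_count_self_le[of "D - D'"] DV unfolding X j(4) by auto
        also have "p * (j + 1)\<^sup>2 = p * j\<^sup>2 + p * (2 * j + 1)"
          by (simp add: power2_eq_square algebra_simps)
        also have "p * (2 * j + 1) \<le> p * (2 * n)"
          using j m'm mn m'0 p 3 n0 by (intro mult_left_mono) (auto simp: j_def)
        finally have waste: "edge_count E (D - D') (D - D') \<le> p * j\<^sup>2 + 3 * \<eta>"
          using \<eta>_bounds(2) by simp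
        define r1 where "r1 = r + k - p * j\<^sup>2"
        have r1: "r1 - 5 * \<eta> \<le> brushes D' B'"
          using waste less.prems(8) D'(5) anchor unfolding r1_def by linarith
        have ne: "D' \<noteq> {}" using 3 n0 by (auto simp: m'_def)
        show ?thesis
        proof (cases "r1 \<le> p * m'\<^sup>2")
          case False
          then show ?thesis
            using game_length_stable_le[OF D'(2), of True] edge_count_self_le[OF D'V] r1
              of_nat_mono[OF card_V_le[OF D'V], where 'a = real] \<eta>_bounds(1)
            unfolding m'_def by (intro crude) linarith
        next
          case True
          \<comment> \<open>From here on the losses are counted from \<open>D'\<close>, so \<open>r2\<close> must not exceed the actual number
            of brushes.\<close>
          define r2 where "r2 = max 0 (r1 - 5 * \<eta>)"
          have "game_length E True (D', B') \<le> rest_value (p * m'\<^sup>2) r2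
            + n + 7 * \<eta> + (200 * \<eta> / n) * m' + (5 * K * \<eta> / n) * m'"
            unfolding m'_def
            using less.hyps[OF card' D'(2) ne order_refl D'V _ D'(3), of r2] r1 n0
            by (auto simp: r2_def edge_count_def)
          moreover have "rest_value (p * m'\<^sup>2) r2 \<le> rest_value (p * (m - 1)\<^sup>2) (r + k) + 5 * \<eta>"
          proof -
            have pos: "0 < p * m'\<^sup>2" using p 3 n0 by auto
            have "rest_value (p * m'\<^sup>2) r2 \<le> rest_value (p * m'\<^sup>2) (r1 - 5 * \<eta>)"
              using True pos \<eta>_bounds(1) by (intro rest_value_antimono) (auto simp: r2_def)
            also have "\<dots> \<le> rest_value (p * m'\<^sup>2) r1 + 5 * \<eta>" using pos by (intro rest_value_shift) auto
            also have "rest_value (p * m'\<^sup>2) r1 \<le> rest_value (p * (m - 1)\<^sup>2) (r + k)"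
              using rest_value_avalanche[OF p(1), of "m - 1" j "r + k"] j True less.prems(7) big n16 
              unfolding r1_def by auto
            finally show ?thesis by simp
          qed
          moreover have "(200 * \<eta> / n) * m' \<le> (200 * \<eta> / n) * (m - 1)"
            using n0 m'm by (intro mult_left_mono) auto
          moreover have "(5 * K * \<eta> / n) * m' + 5 * \<eta> \<le> (5 * K * \<eta> / n) * card D0"
          proof -
            have "real n \<le> K * real (card (D0 - D'))" using 3(2) by (simp flip: of_nat_mult)
            moreover have "real (card (D0 - D')) = card D0 - m'"
              using D'(1) less.prems(3,4) fin' 
              by (simp add: m'_def card_Diff_subset of_nat_diff card_mono finite_subset less_imp_le)
            ultimately have "5 * \<eta> / n * real n \<le> 5 * \<eta> / n * (K * (card D0 - m'))"
              using n0 by (intro mult_left_mono) auto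
            moreover have "5 * \<eta> / n * (K * (card D0 - m')) = (5 * K * \<eta> / n) * card D0 - (5 * K * \<eta> / n) * m'"
              by (simp add: right_diff_distrib diff_divide_distrib ac_simps)
            moreover have "5 * \<eta> / n * real n = 5 * \<eta>" using n0 by simp
            ultimately show ?thesis by linarith
          qed
          ultimately show ?thesis by linarith
        qed
      qed
    qed
    have "game_length E True (D, B) \<le> k + real (game_length E True (D', B'))"
      using D'(6) by linarith
    also have "\<dots> \<le> k + (rest_value (p * (m - 1)\<^sup>2) (r + k)
      + n + 7 * \<eta> + (200 * \<eta> / n) * (m - 1) + (5 * K * \<eta> / n) * card D0)" using target by simp
    also have "(200 * \<eta> / n) * (m - 1) = (200 * \<eta> / n) * m - 200 * \<eta> / n"
      by (simp add: right_diff_distrib)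
    finally show ?thesis using step unfolding m_def[symmetric] by linarith
  qed
qed

theorem game_brush_number_upper:
  "game_brush_number V E \<le> p * n\<^sup>2 / exp 1 + 230 * (p * n\<^sup>2 / K)"
proof -
  have n0: "0 < real n" "0 < real K" using K by (auto intro: Nat.gr0I)
  have K\<eta>: "K * \<eta> = p * n\<^sup>2 / K" by (simp add: \<eta>_def power2_eq_square)
  have small: "4 * \<eta> \<le> K * \<eta>" using K \<eta>_bounds(1) by (intro mult_right_mono) auto
  have n2: "2 \<le> real n" using K power_mono[of 4 K 2] by auto
  obtain v where v: "v \<in> V" using n0 by (intro that[of 1]) auto
  obtain D1 B1 where t1: "turn E v (V, \<lambda>_. 0) = (D1, B1)" by (cases "turn E v (V, \<lambda>_. 0)")
  have gl1: "game_brush_number V E \<le> 1 + game_length E False (D1, B1)"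
    using game_length_Min_le[OF _ v, of E "\<lambda>_. 0"] t1 by (simp add: game_brush_number_def)
  have st1: "stable E D1 B1" and D1: "D1 \<subseteq> V" and rec1: "received E V D1 B1"
    using turn_stable[OF _ t1] turn_fst_subset[OF _ t1] turn_received[OF _ order_refl _ t1]
    by (auto simp: received_def nbrs_def)
  have fin1: "finite D1" using st1 by (simp add: stable_def)
  have triv: "real g \<le> p * n\<^sup>2 / exp 1 + 230 * (p * n\<^sup>2 / K)" if "g \<le> (2::nat)" for g
  proof -
    have "0 \<le> p * n\<^sup>2 / exp 1" using p by simp
    then show ?thesis using that n2 \<eta>_bounds(4) small unfolding K\<eta>[symmetric] by linarith
  qed
  show ?thesis
  proof (cases "D1 = {}")
    case True
    then show ?thesis using gl1 by (intro triv) simp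
  next
    case False
    obtain w where w: "w \<in> D1"
      and gl2: "game_length E False (D1, B1) = 1 + game_length E True (turn E w (D1, B1))"
      using game_length_Max_attained[OF fin1 False] .
    obtain D2 B2 where t2: "turn E w (D1, B1) = (D2, B2)" by (cases "turn E w (D1, B1)")
    have st2: "stable E D2 B2" and D2: "D2 \<subseteq> V" and rec2: "received E V D2 B2"
      using turn_stable[OF fin1 t2] turn_fst_subset[OF fin1 t2] turn_received[OF _ D1 rec1 t2] D1 by auto
    show ?thesis
    proof (cases "D2 = {}")
      case True
      then show ?thesis using gl1 gl2 t2 by (intro triv) simp
    next
      case False
      define m where "m = real (card D2)"
      have m: "0 < m" "m \<le> n" using False st2 card_V_le[OF D2] by (auto simp: m_def stable_def card_gt_0_iff)
      have "game_length E True (D2, B2) \<le> rest_value (p * m\<^sup>2) 0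
        + n + 7 * \<eta> + (200 * \<eta> / n) * m + (5 * K * \<eta> / n) * m"
        unfolding m_def
        using upper_bound_induction[OF st2 False order_refl D2 _ rec2, of 0] n0 by simp
      moreover have "rest_value (p * m\<^sup>2) 0 \<le> p * n\<^sup>2 / exp 1"
      proof -
        have "rest_value (p * m\<^sup>2) 0 = p * m\<^sup>2 / exp 1" by (simp add: rest_value_def exp_minus field_simps)
        then show ?thesis using p m by (auto intro!: divide_right_mono mult_left_mono power_mono)
      qed
      moreover have "(200 * \<eta> / n) * m \<le> (200 * \<eta> / n) * n" "(5 * K * \<eta> / n) * m \<le> (5 * K * \<eta> / n) * n"
        using m n0 \<eta>_bounds(1) by (intro mult_left_mono; simp)+
      ultimately have "game_length E True (D2, B2) \<le> p * n\<^sup>2 / exp 1 + n + 207 * \<eta> + 5 * (K * \<eta>)"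
        using n0 by simp
      moreover have "real (game_brush_number V E) \<le> 2 + game_length E True (D2, B2)"
        using gl1 gl2 t2 by simp
      ultimately show ?thesis
        using small n2 \<eta>_bounds(4) unfolding K\<eta>[symmetric] by linarith
    qed
  qed
qed

end

section \<open>Weights along the firing order\<close>

text \<open>
  Let \<open>q\<close> vertices be dirty when a vertex is completed, let \<open>W\<close> be the level of the brushes, and
  \<open>\<kappa> = n + W / p\<close>.  Then \<open>2 - \<kappa> / q\<close> is the number of brushes this vertex still needs beyond the level,
  divided by \<open>p q\<close>.  The weight is the derivative of the first integral with respect to the number of
  brushes on the dirty vertices.  It is also the amount by which a brush that Min puts on this vertex
  ahead of time lowers the predicted total length of the game.
\<close>

definition weight :: "real \<Rightarrow> real \<Rightarrow> real" where
  "weight \<kappa> q = exp (\<kappa> / q - 2)"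

lemma weight_nonneg [simp]: "0 \<le> weight \<kappa> q"
  by (simp add: weight_def)

lemma weight_mono:
  assumes "0 < q" "q \<le> q'" "\<kappa> \<le> \<kappa>'" "0 \<le> \<kappa>'"
  shows "weight \<kappa> q' \<le> weight \<kappa>' q"
proof -
  have "\<kappa> / q' \<le> \<kappa>' / q'" using assms by (intro divide_right_mono) auto
  also have "\<dots> \<le> \<kappa>' / q" using assms by (intro divide_left_mono) auto
  finally show ?thesis by (simp add: weight_def)
qed

lemma weight_le:
  assumes "0 < N" "N \<le> 2 * q" "\<kappa> \<le> 2 * N"
  shows "weight \<kappa> q \<le> 9"
proof -
  have "\<kappa> \<le> 4 * q" using assms by simp
  then have "\<kappa> / q \<le> 4" using assms by (simp add: divide_le_eq)
  then have "weight \<kappa> q \<le> exp (1 + 1)" by (simp add: weight_def)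
  also have "\<dots> = exp 1 * exp 1" by (simp only: exp_add)
  also have "\<dots> \<le> 3 * 3" using exp_le by (intro mult_mono) auto
  finally show ?thesis by simp
qed

lemma weight_diff_le:
  assumes "1 \<le> N" "N \<le> 2 * (q - 1)" "0 \<le> \<kappa>" "\<kappa> \<le> 2 * N"
  shows "weight \<kappa> (q - 1) - weight \<kappa> q \<le> 72 / N"
proof -
  define u where "u = \<kappa> / (q - 1) - \<kappa> / q"
  have q: "0 < q - 1" "0 < q" using assms by auto
  have "weight \<kappa> q = weight \<kappa> (q - 1) * exp (- u)" by (simp add: weight_def u_def flip: exp_add)
  then have "weight \<kappa> (q - 1) - weight \<kappa> q = weight \<kappa> (q - 1) * (1 - exp (- u))" by (simp add: algebra_simps)
  also have "\<dots> \<le> 9 * u"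
  proof (rule mult_mono)
    show "weight \<kappa> (q - 1) \<le> 9" using assms by (intro weight_le[of N]) auto
    show "1 - exp (- u) \<le> u" using exp_ge_add_one_self[of "- u"] by simp
    have "u = \<kappa> / (q * (q - 1))" using q by (simp add: u_def field_simps)
    then show "0 \<le> 1 - exp (- u)" using assms(3) q by simp
  qed simp
  also have "u \<le> 8 / N"
  proof -
    have "u = \<kappa> / (q * (q - 1))" using q by (simp add: u_def field_simps)
    also have "\<dots> \<le> (2 * N) / (N / 2 * (N / 2))"
      using assms q by (intro frac_le mult_mono) auto
    also have "\<dots> = 8 / N" using assms(1) by (simp add: field_simps)
    finally show ?thesis .
  qed
  finally show ?thesis by simp
qed

text \<open>
  The first integral in terms of the level: the predicted total length of the game if \<open>q\<close> vertices are
  dirty, all of them with \<open>W\<close> brushes from the players, and if no fired vertex had more brushes than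
  it needed.
\<close>

definition flat_value :: "real \<Rightarrow> real \<Rightarrow> real \<Rightarrow> real" where
  "flat_value p \<kappa> q = p * q\<^sup>2 * weight \<kappa> q"

text \<open>
  Completing a vertex at no cost lowers the value at most by the number of its missing brushes,
  \<open>p (2 q - \<kappa>)\<close>, times its weight.
\<close>

lemma flat_value_fire:
  assumes "0 < p" "1 < q" "0 \<le> \<kappa>"
  shows "flat_value p \<kappa> q \<le> flat_value p \<kappa> (q - 1) + weight \<kappa> (q - 1) * max 0 (p * (2 * q - \<kappa>))"
proof -
  have "\<exists>z. q - 1 < z \<and> z < q \<and> flat_value p \<kappa> q - flat_value p \<kappa> (q - 1) =
      (q - (q - 1)) * (p * (2 * z - \<kappa>) * weight \<kappa> z)"
  proof (rule MVT2)
    fix z assume "q - 1 \<le> z" "z \<le> q"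
    then have z: "0 < z" using assms by simp
    have "((\<lambda>z. p * z\<^sup>2 * exp (\<kappa> / z - 2)) has_real_derivative
        p * (2 * z) * exp (\<kappa> / z - 2) + p * z\<^sup>2 * (exp (\<kappa> / z - 2) * (- \<kappa> / z\<^sup>2))) (at z)"
      using z by (auto intro!: derivative_eq_intros simp: power2_eq_square)
    also have "p * (2 * z) * exp (\<kappa> / z - 2) + p * z\<^sup>2 * (exp (\<kappa> / z - 2) * (- \<kappa> / z\<^sup>2)) =
        p * (2 * z - \<kappa>) * weight \<kappa> z"
      using z by (simp add: weight_def field_simps)
    finally show "((\<lambda>q. flat_value p \<kappa> q) has_real_derivative p * (2 * z - \<kappa>) * weight \<kappa> z) (at z)"
      by (simp add: flat_value_def weight_def)
  qed simp
  then obtain z where z: "q - 1 < z" "z < q"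
    "flat_value p \<kappa> q - flat_value p \<kappa> (q - 1) = p * (2 * z - \<kappa>) * weight \<kappa> z" by auto
  have "p * (2 * z - \<kappa>) * weight \<kappa> z \<le> max 0 (p * (2 * q - \<kappa>)) * weight \<kappa> (q - 1)"
  proof (cases "\<kappa> \<le> 2 * z")
    case True
    have "weight \<kappa> z \<le> weight \<kappa> (q - 1)" using z assms by (intro weight_mono) auto
    then show ?thesis using True z assms by (intro mult_mono) (auto simp: le_max_iff_disj)
  next
    case False
    then have "p * (2 * z - \<kappa>) * weight \<kappa> z \<le> 0" using assms by (intro mult_nonpos_nonneg mult_nonneg_nonpos) auto
    also have "0 \<le> max 0 (p * (2 * q - \<kappa>)) * weight \<kappa> (q - 1)" by simp
    finally show ?thesis .
  qed
  then show ?thesis using z(3) by (simp add: mult.commute)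
qed

lemma exp_minus_le:
  fixes y :: real
  assumes "0 \<le> y"
  shows "exp (- y) \<le> 1 - y + y\<^sup>2 / 2"
proof -
  let ?f = "\<lambda>y :: real. 1 - y + y\<^sup>2 / 2 - exp (- y)"
  have "?f 0 \<le> ?f y"
  proof (rule DERIV_nonneg_imp_nondecreasing[where f = ?f])
    fix x :: real
    have "(?f has_real_derivative - 1 + x + exp (- x)) (at x)"
      by (auto intro!: derivative_eq_intros)
    then show "\<exists>d. (?f has_real_derivative d) (at x) \<and> 0 \<le> d"
      using exp_ge_add_one_self[of "- x"] by force
  qed (use assms in auto)
  then show ?thesis by simp
qed

text \<open>
  The other partial derivative: raising the level on \<open>q\<close> vertices by one brush in total increases
  the value by the weight, up to a term of second order.
\<close>

lemma flat_value_raise: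
  assumes "0 < p" "0 < q" "\<kappa> \<le> \<kappa>'" "1 \<le> q * (p * (\<kappa>' - \<kappa>))"
  shows "flat_value p \<kappa> q + weight \<kappa>' q * (1 - 1 / (2 * p * q\<^sup>2)) \<le> flat_value p \<kappa>' q"
proof -
  define y where "y = 1 / (p * q\<^sup>2)"
  have y: "0 < y" using assms by (simp add: y_def)
  have "y \<le> (\<kappa>' - \<kappa>) / q"
    using assms by (simp add: y_def field_simps power2_eq_square)
  then have "weight \<kappa> q \<le> weight \<kappa>' q * exp (- y)"
    by (simp add: weight_def diff_divide_distrib flip: exp_add)
  then have "flat_value p \<kappa> q \<le> p * q\<^sup>2 * (weight \<kappa>' q * exp (- y))"
    unfolding flat_value_def using assms by (intro mult_left_mono) auto
  also have "p * q\<^sup>2 * (weight \<kappa>' q * exp (- y)) \<le> p * q\<^sup>2 * (weight \<kappa>' q * (1 - y + y\<^sup>2 / 2))"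
    using exp_minus_le[of y] y assms by (intro mult_left_mono) auto
  also have "\<dots> = flat_value p \<kappa>' q - weight \<kappa>' q * (1 - 1 / (2 * p * q\<^sup>2))"
    using assms by (simp add: flat_value_def y_def field_simps power2_eq_square)
  finally show ?thesis by simp
qed

lemma flat_value_raise_mono:
  "0 < p \<Longrightarrow> 0 < q \<Longrightarrow> \<kappa> \<le> \<kappa>' \<Longrightarrow> flat_value p \<kappa> q \<le> flat_value p \<kappa>' q"
  by (auto simp: flat_value_def weight_def intro!: mult_left_mono divide_right_mono)

section \<open>The order in which vertices fire\<close>

text \<open>
  The list \<open>vs\<close> contains the clean vertices in an order in which they may have fired, and \<open>b\<close> counts the
  brushes put down by the players on every vertex, clean ones included.
\<close>

definition history :: "'a set set \<Rightarrow> 'a set \<Rightarrow> 'a list \<Rightarrow> 'a set \<Rightarrow> ('a \<Rightarrow> nat) \<Rightarrow> ('a \<Rightarrow> nat) \<Rightarrow> bool" where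
  "history E V vs D B b \<longleftrightarrow> distinct vs \<and> D \<subseteq> V \<and> set vs = V - D \<and>
    (\<forall>v\<in>D. B v = b v + card (nbrs E (V - D) v)) \<and>
    (\<forall>j<length vs. card (nbrs E (V - set (take j vs)) (vs ! j)) \<le>
       b (vs ! j) + card (nbrs E (set (take j vs)) (vs ! j)))"

lemma history_turn:
  assumes "finite V" "history E V vs D B b" "v \<in> D" "turn E v (D, B) = (D', B')"
  shows "\<exists>vs'. history E V (vs @ vs') D' B' (b(v := b v + 1))"
proof -
  let ?b = "b(v := b v + 1)"
  have fin: "finite D" using assms finite_subset by (auto simp: history_def)
  show ?thesis
    using fin assms(4)
  proof (rule turn_invariant[where P = "\<lambda>A C. \<exists>vs'. history E V (vs @ vs') A C ?b"])
    have "vs ! j \<noteq> v" if "j < length vs" for j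
      using nth_mem[OF that] assms(2,3) by (auto simp: history_def)
    then have "history E V (vs @ []) D (B(v := B v + 1)) ?b"
      using assms(2) by (auto simp: history_def)
    then show "\<exists>vs'. history E V (vs @ vs') D (B(v := B v + 1)) ?b" by blast
  next
    fix A C w
    assume A: "finite A" and "\<exists>vs'. history E V (vs @ vs') A C ?b"
      and w: "w \<in> A" "card (nbrs E A w) \<le> C w"
    then obtain vs' where h: "history E V (vs @ vs') A C ?b" by blast
    define us where "us = vs @ vs'"
    note h = h[folded us_def, unfolded history_def]
    have eq: "V - (A - {w}) = (V - A) \<union> {w}" using h w by auto
    have VA: "V - set us = A" using h by auto
    let ?C = "(\<lambda>u. if u \<in> nbrs E A w then C u + 1 else C u)(w := 0)"
    have "history E V (us @ [w]) (A - {w}) ?C ?b"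
      unfolding history_def
    proof (intro conjI ballI allI impI)
      show "distinct (us @ [w])" "A - {w} \<subseteq> V" "set (us @ [w]) = V - (A - {w})"
        using h w by auto
    next
      fix u assume u: "u \<in> A - {w}"
      have "card (nbrs E (V - (A - {w})) u) = card (nbrs E (V - A) u) + card (nbrs E {w} u)"
        unfolding eq using w assms(1) by (subst card_nbrs_Un) auto
      moreover have "nbrs E {w} u = (if u \<in> nbrs E A w then {w} else {})"
        using u by (auto simp: nbrs_def insert_commute)
      ultimately show "?C u = ?b u + card (nbrs E (V - (A - {w})) u)"
        using u h by auto
    next
      fix j assume "j < length (us @ [w])"
      then consider "j < length us" | "j = length us" by fastforce
      then show "card (nbrs E (V - set (take j (us @ [w]))) ((us @ [w]) ! j))
          \<le> ?b ((us @ [w]) ! j) + card (nbrs E (set (take j (us @ [w]))) ((us @ [w]) ! j))"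
      proof cases
        case 1
        then show ?thesis using h by (auto simp: nth_append)
      next
        case 2
        have "C w = ?b w + card (nbrs E (V - A) w)" using h w by blast
        moreover have "set us = V - A" using h by blast
        ultimately show ?thesis using w(2) 2 VA by simp
      qed
    qed
    then show "\<exists>vs'. history E V (vs @ vs') (A - {w}) ?C ?b"
      unfolding us_def by auto
  qed
qed

lemma raise_water:
  fixes Q W :: real
  assumes "finite D" "D \<noteq> {}" "(\<Sum>v\<in>D. max 0 (W - real (b v))) \<le> Q" "0 \<le> Q"
  shows "\<exists>W'\<ge>W. (\<Sum>v\<in>D. max 0 (W' - real (b v))) = Q"
proof -
  obtain v where v: "v \<in> D" using assms(2) by blast
  define U where "U = max W (b v + Q)"
  let ?f = "\<lambda>W. \<Sum>v\<in>D. max 0 (W - real (b v))"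
  have "Q \<le> max 0 (U - b v)" by (simp add: U_def)
  also have "\<dots> \<le> ?f U" using v assms(1) by (intro member_le_sum) auto
  finally have "Q \<le> ?f U" .
  moreover have "continuous_on {W..U} ?f" by (intro continuous_intros)
  ultimately obtain x where "W \<le> x" "x \<le> U" "?f x = Q"
    using IVT'[of ?f W Q U] assms(3) by (auto simp: U_def)
  then show ?thesis by blast
qed

section \<open>Lower bound: Max keeps the brushes level\<close>

context pseudorandom
begin

text \<open>
  The number of brushes that the players must put on the vertex which fires after \<open>j\<close> others: it has
  \<open>p (n - j)\<close> dirty neighbours left and has received \<open>p j\<close> brushes.
\<close>

definition target :: "nat \<Rightarrow> real" where
  "target j = p * (real n - 2 * real j)"

text \<open>
  Suppose that the vertices fire in the order of decreasing \<open>b\<close>.  This is the number of brushes that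
  the first \<open>x\<close> of them lack to reach their targets, counting only brushes above the level \<open>W\<close>.  It is
  computed level by level, which avoids sorting: at height \<open>i\<close>, a brush is needed on the vertices whose
  target reaches \<open>i\<close>, and is present on those with \<open>i \<le> b v\<close>.  Targets are increased by \<open>1\<close> to make up for
  the restriction to integral heights.
\<close>

definition shortfall :: "nat \<Rightarrow> (nat \<Rightarrow> nat) \<Rightarrow> real \<Rightarrow> nat" where
  "shortfall x b W = (\<Sum>i\<in>{i\<in>{..n + 1}. W < real i}.
     card {j\<in>{..<x}. real i \<le> target j + 1} - card {v\<in>V. i \<le> b v})"

text \<open>
  The total length predicted for the continuation in which Min completes the first \<open>x\<close> vertices, those
  that have already fired included, while the level stays at \<open>W\<close>.  The missing brushes are charged
  at the weight that is attained when \<open>x\<close> vertices have fired.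
\<close>

definition lower_potential :: "nat \<Rightarrow> (nat \<Rightarrow> nat) \<Rightarrow> real \<Rightarrow> real" where
  "lower_potential x b W = flat_value p (n + W / p) (real n - x) + weight (n + W / p) (real n - x) * shortfall x b W"

definition num_above :: "(nat \<Rightarrow> nat) \<Rightarrow> real \<Rightarrow> nat" where
  "num_above b W = card {v\<in>V. W < b v}"

text \<open>
  The level \<open>W\<close> is a real number, as if water were poured over the dirty vertices up to the height \<open>W\<close>.
  The volume of the water is kept at \<open>n + 1\<close>; then some dirty vertex is always covered by at
  least one unit, and a brush placed there by Max lies entirely under water.
\<close>

definition water :: "nat set \<Rightarrow> (nat \<Rightarrow> nat) \<Rightarrow> real \<Rightarrow> real" where
  "water D b W = (\<Sum>v\<in>D. max 0 (W - b v))"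

lemma n16: "16 \<le> real n"
proof -
  have "4 * 4 \<le> K * K" using K by (intro mult_mono) auto
  then show ?thesis using K(2) by (simp add: power2_eq_square)
qed

lemma target_antimono: "i \<le> j \<Longrightarrow> target j \<le> target i"
  using p by (simp add: target_def)

lemma shortfall_brush_below:
  assumes "real (b v + 1) \<le> W"
  shows "shortfall x (b(v := b v + 1)) W = shortfall x b W"
  unfolding shortfall_def
proof (intro sum.cong refl)
  fix i assume "i \<in> {i\<in>{..n + 1}. W < real i}"
  then have "real (b v + 1) < real i" using assms by simp
  then have "b v + 1 < i" by (simp only: of_nat_less_iff)
  then have "{u\<in>V. i \<le> (b(v := b v + 1)) u} = {u\<in>V. i \<le> b u}" by auto
  then show "card {j\<in>{..<x}. real i \<le> target j + 1} - card {u\<in>V. i \<le> (b(v := b v + 1)) u} =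
    card {j\<in>{..<x}. real i \<le> target j + 1} - card {u\<in>V. i \<le> b u}" by simp
qed

lemma shortfall_brush: "shortfall x b W \<le> shortfall x (b(v := b v + 1)) W + 1"
proof -
  let ?c = "\<lambda>b i. card {j\<in>{..<x}. real i \<le> target j + 1} - card {u\<in>V. i \<le> b u}"
  let ?I = "{i\<in>{..n + 1}. W < real i}" and ?b = "b(v := b v + 1)"
  have "?c b i \<le> ?c ?b i + (if i = b v + 1 then 1 else 0)" for i
  proof (cases "i = b v + 1")
    case True
    have "card {u\<in>V. i \<le> ?b u} \<le> card (insert v {u\<in>V. i \<le> b u})"
      by (intro card_mono) auto
    also have "\<dots> \<le> card {u\<in>V. i \<le> b u} + 1" by (simp add: card_insert_if)
    finally show ?thesis using True by simp
  next
    case False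
    then have "{u\<in>V. i \<le> ?b u} = {u\<in>V. i \<le> b u}" by auto
    then show ?thesis by simp
  qed
  then have "shortfall x b W \<le> (\<Sum>i\<in>?I. ?c ?b i + (if i = b v + 1 then 1 else 0))"
    unfolding shortfall_def by (intro sum_mono) blast
  also have "\<dots> \<le> shortfall x ?b W + 1"
    by (simp add: shortfall_def sum.distrib)
  finally show ?thesis .
qed

text \<open>
  At every height between the two levels at least \<open>x\<close> vertices have a brush, so nothing is missing there.
\<close>

lemma shortfall_raise:
  assumes "W \<le> W'" "x \<le> num_above b W'"
  shows "shortfall x b W = shortfall x b W'"
  unfolding shortfall_def
proof (rule sum.mono_neutral_right)
  show "\<forall>i\<in>{i \<in> {..n + 1}. W < real i} - {i \<in> {..n + 1}. W' < real i}.
    card {j \<in> {..<x}. real i \<le> target j + 1} - card {v \<in> V. i \<le> b v} = 0"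
  proof
    fix i assume i: "i \<in> {i \<in> {..n + 1}. W < real i} - {i \<in> {..n + 1}. W' < real i}"
    have "card {j \<in> {..<x}. real i \<le> target j + 1} \<le> card {..<x}" by (intro card_mono) auto
    also have "\<dots> \<le> num_above b W'" using assms by simp
    also have "\<dots> \<le> card {v \<in> V. i \<le> b v}"
      unfolding num_above_def using i by (intro card_mono) auto
    finally show "card {j \<in> {..<x}. real i \<le> target j + 1} - card {v \<in> V. i \<le> b v} = 0" by simp
  qed
qed (use assms in auto)

lemma card_levels_ge:
  fixes W c :: real
  assumes "0 \<le> W" "c \<le> n"
  shows "max 0 (c - W) \<le> card {i\<in>{..n + 1}. W < real i \<and> real i \<le> c + 1}"
proof (cases "W < c")
  case True
  have "{nat \<lfloor>W\<rfloor> + 1..nat \<lfloor>c + 1\<rfloor>} \<subseteq> {i\<in>{..n + 1}. W < real i \<and> real i \<le> c + 1}"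
  proof
    fix i assume i: "i \<in> {nat \<lfloor>W\<rfloor> + 1..nat \<lfloor>c + 1\<rfloor>}"
    then have "\<lfloor>W\<rfloor> < int i" "int i \<le> \<lfloor>c + 1\<rfloor>" using assms True by auto
    then have "W < real i" "real i \<le> c + 1" by linarith+
    moreover from this have "i \<le> n + 1" using assms(2) by linarith
    ultimately show "i \<in> {i\<in>{..n + 1}. W < real i \<and> real i \<le> c + 1}" by simp
  qed
  then have "card {nat \<lfloor>W\<rfloor> + 1..nat \<lfloor>c + 1\<rfloor>} \<le> card {i\<in>{..n + 1}. W < real i \<and> real i \<le> c + 1}"
    by (intro card_mono) auto
  moreover have "c - W \<le> real (card {nat \<lfloor>W\<rfloor> + 1..nat \<lfloor>c + 1\<rfloor>})"
  proof -
    have "nat \<lfloor>W\<rfloor> \<le> nat \<lfloor>c + 1\<rfloor>" using True by (intro nat_mono floor_mono) auto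
    then have "real (card {nat \<lfloor>W\<rfloor> + 1..nat \<lfloor>c + 1\<rfloor>}) = real (nat \<lfloor>c + 1\<rfloor>) - real (nat \<lfloor>W\<rfloor>)"
      by (simp add: of_nat_diff)
    moreover have "real (nat \<lfloor>W\<rfloor>) \<le> W" using assms by simp
    moreover have "c \<le> real (nat \<lfloor>c + 1\<rfloor>)" using assms True by linarith
    ultimately show ?thesis by linarith
  qed
  ultimately show ?thesis using True by linarith
qed simp

text \<open>
  Beyond the vertices that stick out of the water, every further vertex needs all brushes between
  the level and its target.
\<close>

lemma shortfall_Suc:
  assumes "num_above b W \<le> x" "0 \<le> W"
  shows "shortfall x b W + max 0 (target x - W) \<le> shortfall (x + 1) b W"
proof -
  let ?a = "\<lambda>x i. card {j\<in>{..<x}. real i \<le> target j + 1}" and ?N = "\<lambda>i. card {v\<in>V. i \<le> b v}"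
  let ?I = "{i\<in>{..n + 1}. W < real i}" and ?J = "{i\<in>{..n + 1}. W < real i \<and> real i \<le> target x + 1}"
  have le: "?a x i - ?N i + (if real i \<le> target x + 1 then 1 else 0) \<le> ?a (x + 1) i - ?N i"
    if "i \<in> ?I" for i
  proof (cases "real i \<le> target x + 1")
    case True
    have "real i \<le> target j + 1" if "j \<le> x" for j using True target_antimono[OF that] by simp
    then have "{j\<in>{..<x}. real i \<le> target j + 1} = {..<x}"
      "{j\<in>{..<x + 1}. real i \<le> target j + 1} = {..<x + 1}" by auto
    moreover have "?N i \<le> num_above b W" unfolding num_above_def using that by (intro card_mono) auto
    ultimately show ?thesis using assms(1) True by simp
  next
    case False
    have "?a x i \<le> ?a (x + 1) i" by (intro card_mono) auto
    then show ?thesis using False by (simp add: diff_le_mono)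
  qed
  have "target x \<le> real n"
    using target_antimono[of 0 x] \<eta>_bounds(3) by (simp add: target_def)
  then have "max 0 (target x - W) \<le> card ?J" using assms(2) by (intro card_levels_ge)
  also have "card ?J = (\<Sum>i\<in>?I. if real i \<le> target x + 1 then 1 else 0)"
    by (simp add: sum.If_cases Int_def conj_ac)
  finally have "shortfall x b W + max 0 (target x - W) \<le>
      real (shortfall x b W + (\<Sum>i\<in>?I. if real i \<le> target x + 1 then 1 else 0))" by simp
  also have "shortfall x b W + (\<Sum>i\<in>?I. if real i \<le> target x + 1 then 1 else 0) \<le> shortfall (x + 1) b W"
    unfolding shortfall_def sum.distrib[symmetric] by (intro sum_mono le)
  finally show ?thesis by simp
qed

lemma kappa_bounds:
  assumes "0 \<le> W" "W \<le> p * n"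
  shows "real n \<le> n + W / p" "n + W / p \<le> 2 * n"
  using assms p by (auto simp: divide_le_eq mult.commute)

text \<open>
  It does not help Min to complete a vertex that is under water ahead of time; so only those \<open>x\<close>
  matter that count vertices sticking out of the water.
\<close>

lemma lower_potential_Suc:
  assumes "num_above b W \<le> x" "0 \<le> W" "2 * x \<le> n"
  shows "lower_potential x b W \<le> lower_potential (x + 1) b W"
proof -
  define q \<kappa> where "q = real n - x" and "\<kappa> = n + W / p"
  have q: "1 < q" "real n - real (x + 1) = q - 1" using assms(3) n16 by (auto simp: q_def)
  have \<kappa>: "0 \<le> \<kappa>" using assms(2) p by (simp add: \<kappa>_def)
  have "p * (2 * q - \<kappa>) = target x - W"
    using p by (simp add: q_def \<kappa>_def target_def algebra_simps)
  then have "flat_value p \<kappa> q \<le> flat_value p \<kappa> (q - 1) + weight \<kappa> (q - 1) * max 0 (target x - W)"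
    using flat_value_fire[OF p(1) q(1) \<kappa>] by simp
  moreover have "weight \<kappa> q * shortfall x b W \<le> weight \<kappa> (q - 1) * shortfall x b W"
    using q \<kappa> by (intro mult_right_mono weight_mono) auto
  moreover have "weight \<kappa> (q - 1) * (shortfall x b W + max 0 (target x - W)) \<le> weight \<kappa> (q - 1) * shortfall (x + 1) b W"
    using shortfall_Suc[OF assms(1,2)] by (intro mult_left_mono) auto
  ultimately show ?thesis unfolding lower_potential_def q(2) q_def[symmetric] \<kappa>_def[symmetric]
    by (simp add: distrib_left)
qed

lemma lower_potential_ge_all:
  assumes "0 \<le> W" "\<And>x. x \<le> num_above b W \<Longrightarrow> 2 * x \<le> n \<Longrightarrow> c \<le> lower_potential x b W" "2 * x \<le> n"
  shows "c \<le> lower_potential x b W"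
proof (cases "x \<le> num_above b W")
  case False
  then have "num_above b W \<le> x" by simp
  then show ?thesis using assms(3)
  proof (induction x rule: dec_induct)
    case base
    then show ?case using assms(2) by simp
  next
    case (step y)
    then show ?case using lower_potential_Suc[OF step(1) assms(1)] by simp
  qed
qed (use assms in blast)

definition potential_ge :: "real \<Rightarrow> (nat \<Rightarrow> nat) \<Rightarrow> real \<Rightarrow> bool" where
  "potential_ge c b W \<longleftrightarrow> (\<forall>x. 2 * x \<le> n \<longrightarrow> c \<le> lower_potential x b W)"

lemma lower_potential_raise_mono:
  assumes "W \<le> W'" "x \<le> num_above b W'" "2 * x \<le> n" "0 \<le> W"
  shows "lower_potential x b W \<le> lower_potential x b W'"
proof -
  have \<kappa>: "n + W / p \<le> n + W' / p" "0 \<le> n + W' / p"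
    using assms p by (auto simp: divide_right_mono)
  have q: "0 < real n - x" using assms(3) n16 by auto
  show ?thesis unfolding lower_potential_def shortfall_raise[OF assms(1,2)]
    using \<kappa> q p by (intro add_mono flat_value_raise_mono mult_right_mono weight_mono) auto
qed

lemma potential_ge_raise:
  assumes "potential_ge c b W" "W \<le> W'" "0 \<le> W"
  shows "potential_ge c b W'"
  unfolding potential_ge_def
proof (intro allI impI)
  fix x assume x: "2 * x \<le> n"
  show "c \<le> lower_potential x b W'"
  proof (rule lower_potential_ge_all[OF _ _ x])
    fix y assume y: "y \<le> num_above b W'" "2 * y \<le> n"
    then show "c \<le> lower_potential y b W'"
      using lower_potential_raise_mono[OF assms(2) y assms(3)] assms(1) by (force simp: potential_ge_def)
  qed (use assms in simp)
qed

lemma water_mono: "W \<le> W' \<Longrightarrow> water D b W \<le> water D b W'"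
  unfolding water_def by (intro sum_mono) auto

text \<open>
  The level rises only on vertices that are under water, and these number at most \<open>n - x\<close> whenever
  \<open>x\<close> vertices stick out.
\<close>

lemma water_diff_le:
  assumes "D \<subseteq> V" "W \<le> W'"
  shows "water D b W' - water D b W \<le> (real n - num_above b W') * (W' - W)"
proof -
  have fin: "finite D" using assms finite_subset by blast
  have "water D b W' - water D b W = (\<Sum>v\<in>D. max 0 (W' - b v) - max 0 (W - b v))"
    by (simp add: water_def sum_subtractf)
  also have "\<dots> \<le> (\<Sum>v\<in>D. if W' < b v then 0 else W' - W)"
    using assms(2) by (intro sum_mono) auto
  also have "\<dots> \<le> (\<Sum>v\<in>V. if W' < b v then 0 else W' - W)"
    using assms by (intro sum_mono2) auto
  also have "\<dots> = card (V - {v\<in>V. W' < b v}) * (W' - W)"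
  proof -
    have "V \<inter> - {v. W' < b v} = V - {v\<in>V. W' < b v}" by auto
    then show ?thesis by (simp add: sum.If_cases)
  qed
  also have "real (card (V - {v\<in>V. W' < b v})) = real n - num_above b W'"
  proof -
    have "card (V - {v\<in>V. W' < b v}) = n - num_above b W'"
      unfolding num_above_def by (subst card_Diff_subset) auto
    moreover have "num_above b W' \<le> n" unfolding num_above_def by (rule card_V_le) auto
    ultimately show ?thesis by (simp add: of_nat_diff)
  qed
  finally show ?thesis .
qed

text \<open>
  A turn of Max makes room for one more unit of water.  It spreads over at most \<open>n - x\<close> vertices
  and so increases the potential by the weight; the second-order term is absorbed in \<open>18 / n\<close>.
\<close>

lemma lower_potential_raise:
  assumes "D \<subseteq> V" "W \<le> W'" "0 \<le> W" "W' \<le> p * n" "water D b W + 1 \<le> water D b W'"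
    "x \<le> num_above b W'" "2 * x \<le> n"
  shows "lower_potential x b W + weight (n + W' / p) (real n - x) \<le> lower_potential x b W' + 18 / n"
proof -
  define q \<kappa> \<kappa>' where "q = real n - x" and "\<kappa> = n + W / p" and "\<kappa>' = n + W' / p"
  have \<kappa>: "\<kappa> \<le> \<kappa>'" "0 \<le> \<kappa>'" "\<kappa>' \<le> 2 * n" and pk: "p * (\<kappa>' - \<kappa>) = W' - W"
    using kappa_bounds[of W'] assms p by (auto simp: \<kappa>_def \<kappa>'_def divide_right_mono right_diff_distrib)
  have q: "0 < q" "n \<le> 2 * q" using assms(7) n16 by (auto simp: q_def)
  have "1 \<le> (real n - num_above b W') * (W' - W)" using water_diff_le[OF assms(1,2), of b] assms(5) by simp
  also have "\<dots> \<le> q * (p * (\<kappa>' - \<kappa>))"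
    unfolding pk q_def using assms by (intro mult_right_mono) auto
  finally have "flat_value p \<kappa> q + weight \<kappa>' q * (1 - 1 / (2 * p * q\<^sup>2)) \<le> flat_value p \<kappa>' q"
    using p q \<kappa> by (intro flat_value_raise) auto
  moreover have "weight \<kappa>' q * (1 / (2 * p * q\<^sup>2)) \<le> 18 / n"
  proof -
    have w9: "weight \<kappa>' q \<le> 9" using q \<kappa> n16 by (intro weight_le[of n]) auto
    have "1 \<le> p * n" using K by linarith
    then have "1 * real n \<le> p * n * n" by (intro mult_right_mono) auto
    also have "(real n)\<^sup>2 \<le> (2 * q)\<^sup>2" using q by (intro power_mono) auto
    then have "p * n * n \<le> p * (4 * q\<^sup>2)"
      using p by (simp add: power2_eq_square mult.assoc)
    finally have "1 / (2 * p * q\<^sup>2) \<le> 2 / n"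
      using q p n16 by (simp add: field_simps)
    then have "weight \<kappa>' q * (1 / (2 * p * q\<^sup>2)) \<le> 9 * (2 / n)"
      using w9 p q by (intro mult_mono) auto
    then show ?thesis by simp
  qed
  moreover have "weight \<kappa> q * shortfall x b W' \<le> weight \<kappa>' q * shortfall x b W'"
    using q \<kappa> by (intro mult_right_mono weight_mono) auto
  ultimately show ?thesis
    unfolding lower_potential_def shortfall_raise[OF assms(2,6)] q_def[symmetric] \<kappa>_def[symmetric] \<kappa>'_def[symmetric]
    by (simp add: right_diff_distrib)
qed

lemma num_above_brush_le: "num_above (b(v := b v + 1)) W \<le> num_above b W + 1"
proof -
  have "num_above (b(v := b v + 1)) W \<le> card (insert v {u\<in>V. W < b u})"
    unfolding num_above_def by (intro card_mono) auto
  also have "\<dots> \<le> num_above b W + 1" by (simp add: num_above_def card_insert_if)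
  finally show ?thesis .
qed

lemma lower_potential_brush: "lower_potential x b W \<le> lower_potential x (b(v := b v + 1)) W + weight (n + W / p) (real n - x)"
proof -
  have "real (shortfall x b W) \<le> shortfall x (b(v := b v + 1)) W + 1"
    using of_nat_mono[OF shortfall_brush[of x b W v]] by simp
  then have "weight (n + W / p) (real n - x) * shortfall x b W \<le>
      weight (n + W / p) (real n - x) * (shortfall x (b(v := b v + 1)) W + 1)" by (intro mult_left_mono) auto
  then show ?thesis by (simp add: lower_potential_def distrib_left)
qed

text \<open>
  A brush of Min lowers the potential by at most the weight.  It may also lift a new vertex out
  of the water, so that one more \<open>x\<close> must be considered; the corresponding weight exceeds the
  previous one by at most \<open>72 / n\<close>.
\<close>

lemma potential_ge_brush:
  assumes c: "\<And>x. x \<le> num_above b W \<Longrightarrow> 2 * x \<le> n \<Longrightarrow>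
      c + weight (n + W / p) (real n - x) \<le> lower_potential x b W + 18 / n"
    and W: "0 \<le> W" "W \<le> p * n"
  shows "potential_ge (c - 90 / n) (b(v := b v + 1)) W"
  unfolding potential_ge_def
proof (intro allI impI)
  fix x assume x: "2 * x \<le> n"
  show "c - 90 / n \<le> lower_potential x (b(v := b v + 1)) W"
  proof (rule lower_potential_ge_all[OF W(1) _ x])
    fix y assume y: "y \<le> num_above (b(v := b v + 1)) W" "2 * y \<le> n"
    show "c - 90 / n \<le> lower_potential y (b(v := b v + 1)) W"
    proof (cases "y \<le> num_above b W")
      case True
      have "18 / real n \<le> 90 / n" using n16 by (intro divide_right_mono) auto
      then show ?thesis using c[OF True y(2)] lower_potential_brush[of y b W v] by linarith
    next
      case False
      define s where "s = num_above b W"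
      have ys: "y = s + 1" using False y(1) num_above_brush_le[of b v W] by (simp add: s_def)
      have s: "2 * s \<le> n" using ys y(2) by simp
      have "lower_potential s b W \<le> lower_potential y b W"
        unfolding ys using s W by (intro lower_potential_Suc) (auto simp: s_def)
      moreover have "weight (n + W / p) (real n - y) - weight (n + W / p) (real n - s) \<le> 72 / n"
      proof -
        have "real n - y = (real n - s) - 1" using ys by simp
        moreover have "real (2 * (s + 1)) \<le> real n" using y(2) ys by (intro of_nat_mono) simp
        ultimately show ?thesis using kappa_bounds[OF W] n16
          by (simp only:) (intro weight_diff_le; simp)
      qed
      moreover have "c + weight (n + W / p) (real n - s) \<le> lower_potential s b W + 18 / n"
        using c[of s] s by (simp add: s_def)
      moreover have "18 / real n + 72 / n = 90 / n" by (simp flip: add_divide_distrib)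
      ultimately show ?thesis using lower_potential_brush[of y b W v] by linarith
    qed
  qed
qed

lemma length_history: "history E V vs D B b \<Longrightarrow> length vs \<le> n"
  using distinct_card[of vs] card_V_le[of "set vs"] by (auto simp: history_def)

text \<open>
  Deviations of individual vertices from the mean degree cannot be excluded, but their sum is small.
  Let \<open>P\<close> be the positions at which brushes are missing.  The edges from these vertices to the
  earlier ones are counted in \<open>K\<close> blocks of consecutive positions, where all earlier
  vertices are replaced by all vertices up to the end of the block; every block contributes one error
  \<open>\<eta>\<close>, and the replacement costs about \<open>p n / K\<close> for each position.
\<close>

lemma missing_brushes_le:
  assumes h: "history E V vs D B b" and k: "k \<le> length vs"
  shows "(\<Sum>j<k. max 0 (target j - b (vs ! j))) \<le> 5 * (K * \<eta>)"
proof -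
  define P where "P = {j\<in>{..<k}. real (b (vs ! j)) < target j}"
  \<comment> \<open>The length of the blocks; \<open>K\<close> of them cover all positions.\<close>
  define L where "L = n div K + 1"
  define rec where "rec = (\<lambda>j. card (nbrs E (set (take j vs)) (vs ! j)))"
  have K0: "0 < K" using K by simp
  have Pk: "j < length vs" "j < n" if "j \<in> P" for j
    using that k length_history[OF h] by (auto simp: P_def)
  have finP: "finite P" by (simp add: P_def)
  have "card P \<le> card {..<k}" by (intro card_mono) (auto simp: P_def)
  then have nP: "real (card P) \<le> n" using k length_history[OF h] by simp
  have vsV: "set vs \<subseteq> V" using h by (auto simp: history_def)
  have inj: "inj_on (nth vs) P"
    using h Pk by (intro inj_on_nth) (auto simp: history_def)
  have nV: "nth vs ` I \<subseteq> V" if "I \<subseteq> P" for I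
    using nth_mem[OF Pk(1)] that vsV by blast
  have U: "nth vs ` I \<subseteq> V" "card (nth vs ` I) = card I"
     "edge_count E (nth vs ` I) T = (\<Sum>j\<in>I. card (nbrs E T (vs ! j)))" if "I \<subseteq> P" for I T
    using nV[OF that] inj_on_subset[OF inj that]
    by (simp_all add: card_image edge_count_def sum.reindex)
  have "(\<Sum>j<k. max 0 (target j - b (vs ! j))) = (\<Sum>j\<in>P. target j - b (vs ! j))"
    by (intro sum.mono_neutral_cong_right) (auto simp: P_def)
  also have "\<dots> \<le> (\<Sum>j\<in>P. target j - card (nbrs E V (vs ! j)) + 2 * rec j)"
  proof (intro sum_mono)
    fix j assume j: "j \<in> P"
    have "set (take j vs) \<subseteq> V" using vsV set_take_subset[of j vs] by blast
    then have "card (nbrs E V (vs ! j)) = rec j + card (nbrs E (V - set (take j vs)) (vs ! j))"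
      using card_nbrs_Un[of "set (take j vs)" "V - set (take j vs)" E "vs ! j"]
      by (simp add: rec_def Un_absorb1)
    also have "card (nbrs E (V - set (take j vs)) (vs ! j)) \<le> b (vs ! j) + rec j"
      using h Pk[OF j] by (simp add: history_def rec_def)
    finally show "target j - b (vs ! j) \<le> target j - card (nbrs E V (vs ! j)) + 2 * rec j" by linarith
  qed
  also have "\<dots> = (\<Sum>j\<in>P. target j) - edge_count E (nth vs ` P) V + 2 * real (\<Sum>j\<in>P. rec j)"
    (is "_ = ?bound")
    by (simp add: U(3) sum.distrib sum_subtractf sum_distrib_left)
  finally have sum_le: "(\<Sum>j<k. max 0 (target j - b (vs ! j))) \<le> ?bound" .
  have degrees: "real (edge_count E (nth vs ` P) V) \<ge> p * card P * n - \<eta>"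
    using edge_count_bounds(2)[of "nth vs ` P" V] U(1,2)[of P] by simp
  have rec_le: "real (\<Sum>j\<in>P. rec j) \<le> (\<Sum>j\<in>P. p * j) + p * L * n + K * \<eta>"
  proof -
    have KL: "n < K * L" unfolding L_def using K0 dividend_less_times_div[of K n] by simp
    have blk: "j div L < K" if "j \<in> P" for j
      using Pk(2)[OF that] KL by (simp add: less_mult_imp_div_less)
    have "(\<Sum>j\<in>P. rec j) = (\<Sum>i<K. \<Sum>j\<in>{j\<in>P. j div L = i}. rec j)"
      using finP blk by (intro sum.group[symmetric]) auto
    also have "\<dots> \<le> (\<Sum>i<K. edge_count E (nth vs ` {j\<in>P. j div L = i}) (set (take ((i + 1) * L) vs)))"
    proof (intro sum_mono)
      fix i
      show "(\<Sum>j\<in>{j\<in>P. j div L = i}. rec j) \<le>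
        edge_count E (nth vs ` {j\<in>P. j div L = i}) (set (take ((i + 1) * L) vs))"
        unfolding rec_def
      proof (subst U(3), blast, intro sum_mono card_nbrs_mono set_take_subset_set_take)
        fix j assume "j \<in> {j\<in>P. j div L = i}"
        then have "j < (i + 1) * L"
          using dividend_less_div_times[of L j] by (auto simp: L_def algebra_simps)
        then show "j \<le> (i + 1) * L" by simp
      qed auto
    qed
    also have "real \<dots> \<le> (\<Sum>i<K. (\<Sum>j\<in>{j\<in>P. j div L = i}. p * j + p * L) + \<eta>)"
      unfolding of_nat_sum
    proof (intro sum_mono)
      fix i
      let ?I = "{j\<in>P. j div L = i}" and ?T = "set (take ((i + 1) * L) vs)"
      have "real (edge_count E (nth vs ` ?I) ?T) \<le> p * card ?I * card ?T + \<eta>"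
        using edge_count_bounds(1)[of "nth vs ` ?I" ?T] U(1,2)[of ?I] vsV
          set_take_subset[of "(i + 1) * L" vs] by auto
      also have "p * card ?I * card ?T \<le> p * card ?I * real ((i + 1) * L)"
        using p card_length[of "take ((i + 1) * L) vs"]
        by (intro mult_left_mono of_nat_mono) auto
      also have "\<dots> = (\<Sum>j\<in>?I. p * real ((i + 1) * L))" by simp
      also have "\<dots> \<le> (\<Sum>j\<in>?I. p * j + p * L)"
      proof (intro sum_mono)
        fix j assume "j \<in> ?I"
        then have "(i + 1) * L \<le> j + L" using div_times_less_eq_dividend[of j L] by auto
        then have "real ((i + 1) * L) \<le> real (j + L)" by (rule of_nat_mono)
        then have "p * real ((i + 1) * L) \<le> p * real (j + L)" using p by (intro mult_left_mono) auto
        then show "p * real ((i + 1) * L) \<le> p * j + p * L" by (simp add: distrib_left)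
      qed
      finally show "real (edge_count E (nth vs ` ?I) ?T) \<le> (\<Sum>j\<in>?I. p * j + p * L) + \<eta>" by simp
    qed
    also have "\<dots> = (\<Sum>j\<in>P. p * j + p * L) + K * \<eta>"
    proof -
      have "(\<Sum>i<K. \<Sum>j\<in>{j\<in>P. j div L = i}. p * j + p * L) = (\<Sum>j\<in>P. p * j + p * L)"
        using finP blk by (intro sum.group) auto
      then show ?thesis by (simp only: sum.distrib) simp
    qed
    also have "(\<Sum>j\<in>P. p * j + p * L) = (\<Sum>j\<in>P. p * j) + p * L * card P" by (simp add: sum.distrib)
    also have "p * L * card P \<le> p * L * n" using p nP by (intro mult_left_mono) auto
    finally show ?thesis by simp
  qed
  have "(\<Sum>j\<in>P. target j) = p * card P * n - 2 * (\<Sum>j\<in>P. p * j)"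
    by (simp add: target_def right_diff_distrib sum_subtractf sum_distrib_left mult.commute mult.left_commute)
  then have "(\<Sum>j<k. max 0 (target j - b (vs ! j))) \<le> \<eta> + 2 * (p * L * n) + 2 * (K * \<eta>)"
    using sum_le degrees rec_le by linarith
  also have "p * L * n \<le> K * \<eta> + \<eta>"
  proof -
    have "real (n div K) \<le> n / K" by (rule of_nat_div_le_of_nat)
    then have "p * n * L \<le> p * n * (n / K + 1)" using p by (intro mult_left_mono) (auto simp: L_def)
    also have "\<dots> = K * \<eta> + p * n" using K0 by (simp add: \<eta>_def power2_eq_square distrib_left)
    finally show ?thesis using \<eta>_bounds(2) by (simp add: ac_simps)
  qed
  also have "\<eta> + 2 * (K * \<eta> + \<eta>) + 2 * (K * \<eta>) \<le> 5 * (K * \<eta>)"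
  proof -
    have "4 * \<eta> \<le> K * \<eta>" using K \<eta>_bounds(1) by (intro mult_right_mono) auto
    moreover have "\<eta> + 2 * (t + \<eta>) + 2 * t \<le> 5 * t" if "4 * \<eta> \<le> t" for t
    proof -
      have "3 * \<eta> \<le> t" using that \<eta>_bounds(1) by simp
      then show ?thesis by (simp add: algebra_simps)
    qed
    ultimately show ?thesis by blast
  qed
  finally show ?thesis by simp
qed

lemma shortfall_le_missing:
  assumes h: "history E V vs D B b" and k: "k \<le> length vs" and "0 \<le> W"
  shows "real (shortfall k b W) \<le> (\<Sum>j<k. max 0 (target j + 1 - b (vs ! j)))"
proof -
  let ?I = "{i\<in>{..n + 1}. W < real i}"
  let ?R = "\<lambda>i j. b (vs ! j) < i \<and> real i \<le> target j + 1"
  have vsV: "set vs \<subseteq> V" and dist: "distinct vs" using h by (auto simp: history_def)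
  have "shortfall k b W \<le> (\<Sum>i\<in>?I. card {j\<in>{..<k}. ?R i j})"
    unfolding shortfall_def
  proof (intro sum_mono)
    fix i
    let ?A = "{j\<in>{..<k}. real i \<le> target j + 1}" and ?N = "{v\<in>V. i \<le> b v}"
    have "card ?A = card {j\<in>?A. i \<le> b (vs ! j)} + card {j\<in>{..<k}. ?R i j}"
      by (subst card_Un_disjoint[symmetric]) (auto intro!: arg_cong[of _ _ card])
    moreover have "card {j\<in>?A. i \<le> b (vs ! j)} \<le> card ?N"
      using k vsV nth_mem[of _ vs]
      by (intro card_inj_on_le[of "nth vs"] inj_on_nth[OF dist]) fastforce+
    ultimately show "card ?A - card ?N \<le> card {j\<in>{..<k}. ?R i j}" by linarith
  qed
  also have "\<dots> = (\<Sum>j<k. card {i\<in>?I. ?R i j})"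
    by (rule sum_multicount_gen) auto
  finally have "real (shortfall k b W) \<le> (\<Sum>j<k. real (card {i\<in>?I. ?R i j}))"
    by (simp flip: of_nat_sum)
  also have "\<dots> \<le> (\<Sum>j<k. max 0 (target j + 1 - b (vs ! j)))"
  proof (intro sum_mono)
    fix j
    define l where "l = nat \<lfloor>target j + 1\<rfloor>"
    have l: "i \<le> l" if "real i \<le> target j + 1" for i
      using that unfolding l_def by (rule le_nat_floor)
    have "real l \<le> max 0 (target j + 1)" unfolding l_def by linarith
    have "card {i\<in>?I. ?R i j} \<le> card {b (vs ! j) + 1..l}"
      using l by (intro card_mono) auto
    then have "real (card {i\<in>?I. ?R i j}) \<le> real (l - b (vs ! j))"
      by (intro of_nat_mono) simp
    also have "\<dots> \<le> max 0 (target j + 1 - b (vs ! j))"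
      using \<open>real l \<le> max 0 (target j + 1)\<close> by linarith
    finally show "real (card {i\<in>?I. ?R i j}) \<le> max 0 (target j + 1 - b (vs ! j))" .
  qed
  finally show ?thesis .
qed

text \<open>
  When the target of the next vertex has come down to the level, nothing remains to be done for Min: the
  fired vertices have about \<open>p (n - 2 j)\<close> brushes and the others the level \<open>W\<close>.  With \<open>q = n - k\<close> this sums
  up to about \<open>p k q + q W = p q (\<kappa> - q)\<close>, which is \<open>p q\<^sup>2 = flat_value p \<kappa> q\<close> when \<open>\<kappa> = 2 q\<close>.
\<close>

lemma final_position:
  assumes h: "history E V vs D B b" and k: "k \<le> length vs" and "0 \<le> W"
    and tk: "W \<le> target k" "target k \<le> W + 2 * p"
    and d: "water (V - set (take k vs)) b W \<le> n + 1"
  shows "2 * k \<le> n" "lower_potential k b W \<le> brushes V b + 14 * (K * \<eta>)"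
proof -
  define q \<kappa> where "q = real n - k" and "\<kappa> = n + W / p"
  have "0 \<le> target k" using assms by simp
  then have "2 * real k \<le> n" using p by (simp add: target_def zero_le_mult_iff)
  then show k2: "2 * k \<le> n" by linarith
  have q: "0 < q" "q \<le> n" using k2 n16 by (auto simp: q_def)
  have tq: "p * (2 * q - \<kappa>) = target k - W"
    using p by (simp add: q_def \<kappa>_def target_def algebra_simps)
  then have "0 \<le> p * (2 * q - \<kappa>)" "p * (2 * q - \<kappa>) \<le> p * 2" using tk by auto
  then have \<kappa>: "\<kappa> \<le> 2 * q" "2 * q - 2 \<le> \<kappa>" using p by (auto simp: zero_le_mult_iff)
  have w1: "weight \<kappa> q \<le> 1" using \<kappa> q by (simp add: weight_def divide_le_eq)
  have vsV: "set vs \<subseteq> V" and dist: "distinct vs" using h by (auto simp: history_def)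
  let ?F = "set (take k vs)"
  have F: "?F = nth vs ` {..<k}" using k by (simp add: nth_image lessThan_atLeast0)
  have FV: "?F \<subseteq> V" using vsV set_take_subset by force
  have inj: "inj_on (nth vs) {..<k}" using k by (intro inj_on_nth dist) auto
  let ?err = "\<Sum>j<k. max 0 (target j - b (vs ! j))"
  note err = missing_brushes_le[OF h k]
  have "real (shortfall k b W) \<le> ?err + n"
  proof -
    have "real (shortfall k b W) \<le> (\<Sum>j<k. max 0 (target j + 1 - b (vs ! j)))"
      by (rule shortfall_le_missing[OF h k assms(3)])
    also have "\<dots> \<le> (\<Sum>j<k. max 0 (target j - b (vs ! j)) + 1)" by (intro sum_mono) auto
    also have "\<dots> = ?err + k" by (simp add: sum.distrib)
    finally show ?thesis using k2 by simp
  qed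
  then have "weight \<kappa> q * shortfall k b W \<le> 1 * (?err + n)" using w1 by (intro mult_mono) auto
  then have "weight \<kappa> q * shortfall k b W \<le> ?err + n" by simp
  moreover have "flat_value p \<kappa> q \<le> p * q\<^sup>2" using w1 p unfolding flat_value_def by (intro mult_left_le) auto
  ultimately have potential: "lower_potential k b W \<le> p * q\<^sup>2 + 5 * (K * \<eta>) + n"
    using err unfolding lower_potential_def q_def[symmetric] \<kappa>_def[symmetric] by linarith
  have "real (brushes V b) = (\<Sum>v\<in>?F. real (b v)) + (\<Sum>v\<in>V - ?F. real (b v))"
    unfolding brushes_def of_nat_sum using FV by (subst sum.subset_diff[of ?F V]) auto
  also have "(\<Sum>v\<in>?F. real (b v)) = (\<Sum>j<k. real (b (vs ! j)))"
    unfolding F by (simp add: sum.reindex[OF inj])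
  finally have br: "real (brushes V b) = (\<Sum>j<k. real (b (vs ! j))) + (\<Sum>v\<in>V - ?F. real (b v))" .
  have "(\<Sum>j<k. target j) - ?err \<le> (\<Sum>j<k. real (b (vs ! j)))"
    unfolding sum_subtractf[symmetric] by (intro sum_mono) auto
  moreover have "p * k * q \<le> (\<Sum>j<k. target j)"
  proof -
    have "(\<Sum>j<k. target j) = p * (real k * n - real k * (real k - 1))" for k :: nat
      by (induction k) (simp_all add: target_def algebra_simps)
    moreover have "p * k * q \<le> p * (real k * n - real k * (real k - 1))"
      using p by (simp add: q_def algebra_simps)
    ultimately show ?thesis by simp
  qed
  moreover have "q * W - (n + 1) \<le> (\<Sum>v\<in>V - ?F. real (b v))"
  proof -
    have "q * W = (\<Sum>v\<in>V - ?F. W)"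
      using FV k2 distinct_card[OF distinct_take[OF dist], of k] k
      by (simp add: card_Diff_subset q_def of_nat_diff)
    also have "\<dots> \<le> (\<Sum>v\<in>V - ?F. real (b v) + max 0 (W - b v))" by (intro sum_mono) auto
    also have "\<dots> = (\<Sum>v\<in>V - ?F. real (b v)) + water (V - ?F) b W"
      by (simp add: water_def sum.distrib)
    finally show ?thesis using d by simp
  qed
  moreover have "p * q\<^sup>2 - 2 * (p * n) \<le> p * k * q + q * W"
  proof -
    have "p * k * q + q * W = q * (p * (\<kappa> - q))"
      using p by (simp add: q_def \<kappa>_def algebra_simps)
    also have "\<dots> \<ge> q * (p * (q - 2))" using \<kappa> p q by (intro mult_left_mono) auto
    also have "q * (p * (q - 2)) = p * q\<^sup>2 - 2 * (p * q)" by (simp add: power2_eq_square algebra_simps)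
    moreover have "p * q \<le> p * n" using q p by (intro mult_left_mono) auto
    ultimately show ?thesis by linarith
  qed
  moreover have "2 * (p * n) \<le> K * \<eta>"
  proof -
    have "4 * \<eta> \<le> K * \<eta>" using K \<eta>_bounds(1) by (intro mult_right_mono) auto
    then show ?thesis using \<eta>_bounds(1,2) by linarith
  qed
  ultimately show "lower_potential k b W \<le> brushes V b + 14 * (K * \<eta>)"
    using potential err br \<eta>_bounds(4) n16 by linarith
qed

text \<open>
  Targets drop by \<open>2 p\<close> from one position to the next, so some position between the two given ones
  has its target within \<open>2 p\<close> of the level.
\<close>

lemma stopped_game:
  assumes h: "history E V (vs @ vs') D B b" and "0 \<le> W"
    and t: "W \<le> target (length vs)" "target (length (vs @ vs')) \<le> W"
    and d: "water (V - set vs) b W \<le> n + 1" and g: "potential_ge c b W"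
  shows "c \<le> brushes V b + 14 * (K * \<eta>)"
proof -
  \<comment> \<open>The last position whose target is not below the level.\<close>
  define P where "P = (\<lambda>k. k \<le> length (vs @ vs') \<and> W \<le> target k)"
  define k where "k = (GREATEST k. P k)"
  have P: "P (length vs)" and bound: "\<And>k. P k \<Longrightarrow> k \<le> length (vs @ vs')"
    using t by (auto simp: P_def)
  have k: "k \<le> length (vs @ vs')" "W \<le> target k"
    using GreatestI_nat[of P, OF P bound] by (auto simp: k_def P_def)
  have k_max: "j \<le> k" if "P j" for j
    unfolding k_def using that bound by (rule Greatest_le_nat)
  note kl = k_max[OF P]
  have "target k \<le> W + 2 * p"
  proof (cases "k = length (vs @ vs')")
    case True
    then show ?thesis using t p by simp
  next
    case False
    then have "\<not> W \<le> target (k + 1)" using k_max[of "k + 1"] k(1) by (auto simp: P_def)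
    then show ?thesis by (simp add: target_def algebra_simps)
  qed
  moreover have "water (V - set (take k (vs @ vs'))) b W \<le> n + 1"
  proof -
    have "water (V - set (take k (vs @ vs'))) b W \<le> water (V - set vs) b W"
      unfolding water_def using kl by (intro sum_mono2) auto
    then show ?thesis using d by simp
  qed
  ultimately have "2 * k \<le> n" "lower_potential k b W \<le> brushes V b + 14 * (K * \<eta>)"
    using final_position[OF h k(1) assms(2) k(2)] by auto
  then show ?thesis using g by (force simp: potential_ge_def)
qed

text \<open>
  Firing removes vertices and with them water, and the level is raised to restore the volume.  If it would
  pass the target of the next vertex, raising stops there, and the game is already as long as claimed.
\<close>

lemma raise_or_stop:
  assumes h: "history E V vs D B b" and W: "0 \<le> W" "W \<le> target (length vs)"
    and d: "water D b W \<le> n + 1" and g: "potential_ge c b W"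
  obtains "c \<le> brushes V b + 14 * (K * \<eta>)"
    | W' where "W \<le> W'" "W' \<le> target (length vs)" "water D b W' = n + 1"
proof -
  have D: "D \<subseteq> V" "V - set vs = D" "set vs = V - D" using h by (auto simp: history_def)
  have "target n = - (p * n)" by (simp add: target_def algebra_simps)
  moreover have "0 < p * n" using p n16 by simp
  ultimately have "length vs \<noteq> n" using W by force
  then have "D \<noteq> {}" using D h distinct_card[of vs] by (auto simp: history_def)
  moreover have "finite D" using finite_subset[OF D(1)] by simp
  ultimately obtain W' where W': "W \<le> W'" "water D b W' = n + 1"
    using raise_water[of D W b "n + 1"] d unfolding water_def by auto
  show thesis
  proof (cases "W' \<le> target (length vs)")
    case True
    then show thesis using W' that(2) by blast
  next
    case False
    let ?t = "target (length vs)"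
    have "water D b ?t \<le> n + 1" using water_mono[of ?t W' D b] False W' by simp
    then have "c \<le> brushes V b + 14 * (K * \<eta>)"
      using stopped_game[of vs "[]" D B b ?t c] h D W potential_ge_raise[OF g W(2,1)] by simp
    then show thesis by (rule that(1))
  qed
qed

lemma brushes_upd: "finite A \<Longrightarrow> v \<in> A \<Longrightarrow> brushes A (b(v := b v + 1)) = brushes A b + 1"
  by (simp add: brushes_def sum.remove[of A v])

lemma target_le: "target k \<le> p * n"
  using target_antimono[of 0 k] by (simp add: target_def)

text \<open>
  The induction hypothesis for positions in which it is Max's turn.  The factor \<open>1 + 90 / n\<close> pays for the
  loss of potential in the single rounds.
\<close>

definition max_turn_bound :: "nat set \<Rightarrow> (nat \<Rightarrow> nat) \<Rightarrow> bool" where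
  "max_turn_bound D B \<longleftrightarrow> (\<forall>vs b W c. history E V vs D B b \<longrightarrow> water D b W = n + 1 \<longrightarrow> 0 \<le> W \<longrightarrow>
     W \<le> target (length vs) \<longrightarrow> potential_ge c b W \<longrightarrow>
     c \<le> brushes V b + 14 * (K * \<eta>) + (1 + 90 / n) * game_length E False (D, B))"

text \<open>
  Rounds consist of a turn of Max and the following turn of Min: the level that Max's turn
  determines also determines the weight at which Min's brush is charged.
\<close>

lemma min_turn:
  assumes IH: "\<And>D' B'. game_length E False (D', B') < game_length E True (D, B) \<Longrightarrow> max_turn_bound D' B'"
    and h: "history E V vs D B b" and d: "water D b W = n + 1"
    and W: "0 \<le> W" "W \<le> target (length vs)"
    and c: "\<And>x. x \<le> num_above b W \<Longrightarrow> 2 * x \<le> n \<Longrightarrow>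
      c + weight (n + W / p) (real n - x) \<le> lower_potential x b W + 18 / n"
  shows "c \<le> brushes V b + 14 * (K * \<eta>) + (1 + 90 / n) * game_length E True (D, B)"
proof -
  have D: "D \<subseteq> V" "V - set vs = D" using h by (auto simp: history_def)
  have ne: "D \<noteq> {}" using d by (auto simp: water_def)
  have fin: "finite D" using D finite_subset by auto
  obtain v where v: "v \<in> D"
    and gl: "game_length E True (D, B) = 1 + game_length E False (turn E v (D, B))"
    using game_length_Min_attained[OF fin ne] .
  obtain D' B' where t: "turn E v (D, B) = (D', B')" by (cases "turn E v (D, B)")
  define b' where "b' = b(v := b v + 1)"
  obtain vs' where h': "history E V (vs @ vs') D' B' b'"
    using history_turn[OF _ h v t] by (auto simp: b'_def)
  have D': "V - set (vs @ vs') = D'" "D' \<subseteq> D"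
    using h' turn_fst_subset[OF fin t] by (auto simp: history_def)
  have br: "brushes V b' = brushes V b + 1" unfolding b'_def using v D by (intro brushes_upd) auto
  have g: "potential_ge (c - 90 / n) b' W"
    unfolding b'_def using c W target_le[of "length vs"] by (intro potential_ge_brush) auto
  have db': "water D b' W \<le> n + 1"
    unfolding d[symmetric] water_def by (intro sum_mono) (auto simp: b'_def)
  have "c - 90 / n \<le> brushes V b' + 14 * (K * \<eta>) + (1 + 90 / n) * game_length E False (D', B')"
  proof (cases "target (length (vs @ vs')) \<le> W")
    case True
    have "c - 90 / n \<le> brushes V b' + 14 * (K * \<eta>)"
      using stopped_game[OF h' W True _ g] db' D by simp
    then show ?thesis by (simp add: add_increasing2)
  next
    case False
    have "water D' b' W \<le> water D b' W" unfolding water_def using D' fin by (intro sum_mono2) auto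
    then have "water D' b' W \<le> n + 1" using db' by simp
    \<comment> \<open>Min's brush and the vertices fired by it have changed the volume of the water.\<close>
    with h' W(1) False g show ?thesis
    proof (elim raise_or_stop[of "vs @ vs'" D' B' b' W "c - 90 / n"])
      assume "c - 90 / n \<le> brushes V b' + 14 * (K * \<eta>)"
      then show ?thesis by (simp add: add_increasing2)
    next
      fix W' assume W': "W \<le> W'" "W' \<le> target (length (vs @ vs'))" "water D' b' W' = n + 1"
      have "max_turn_bound D' B'" using gl t by (intro IH) simp
      then show ?thesis using h' W' W potential_ge_raise[OF g W'(1)] unfolding max_turn_bound_def by auto
    qed auto
  qed
  then show ?thesis unfolding gl t br by (simp add: distrib_right distrib_left)
qed

lemma max_turn_bound: "max_turn_bound D B"
proof (induction "game_length E False (D, B)" arbitrary: D B rule: less_induct)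
  case less
  show ?case
    unfolding max_turn_bound_def
  proof (intro allI impI)
    fix vs b W c
    assume h: "history E V vs D B b" and d: "water D b W = n + 1"
      and W: "0 \<le> W" "W \<le> target (length vs)" and g: "potential_ge c b W"
    have D: "D \<subseteq> V" "V - set vs = D" using h by (auto simp: history_def)
    have fin: "finite D" using D finite_subset by auto
    \<comment> \<open>The average depth of the water exceeds one unit.\<close>
    have "\<exists>v\<in>D. b v + 1 \<le> W"
    proof (rule ccontr)
      assume *: "\<not> ?thesis"
      have "W < real (b v) + 1" if "v \<in> D" for v using * that by force
      then have "water D b W \<le> (\<Sum>v\<in>D. 1)" unfolding water_def by (intro sum_mono) force
      then show False using d card_V_le[OF D(1)] by simp
    qed
    then obtain v where v: "v \<in> D" "b v + 1 \<le> W" by blast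
    obtain D' B' where t: "turn E v (D, B) = (D', B')" by (cases "turn E v (D, B)")
    define b' where "b' = b(v := b v + 1)"
    obtain vs' where h': "history E V (vs @ vs') D' B' b'"
      using history_turn[OF _ h v(1) t] by (auto simp: b'_def)
    have D': "V - set (vs @ vs') = D'" "D' \<subseteq> D"
      using h' turn_fst_subset[OF fin t] by (auto simp: history_def)
    have br: "brushes V b' = brushes V b + 1"
      unfolding b'_def using v D by (intro brushes_upd) auto
    have gl: "1 + game_length E True (D', B') \<le> game_length E False (D, B)"
      using game_length_Max_ge[OF fin v(1), of E B] t by simp
    have num_above: "num_above b' W = num_above b W"
      unfolding num_above_def b'_def using v(2) by (intro arg_cong[of _ _ card]) auto
    have potential': "lower_potential x b' W = lower_potential x b W" for x
      using shortfall_brush_below[of b v W x, OF v(2)] by (simp add: lower_potential_def b'_def)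
    have g': "potential_ge c b' W" using g by (simp add: potential_ge_def potential')
    have db: "water D b' W + 1 = water D b W"
      using v fin by (simp add: water_def b'_def sum.remove[of D v])
    have "water D' b' W \<le> water D b' W" unfolding water_def using D' fin by (intro sum_mono2) auto
    then have dD': "water D' b' W + 1 \<le> n + 1" using db d by simp
    have "c \<le> brushes V b' + 14 * (K * \<eta>) + (1 + 90 / n) * game_length E True (D', B')"
    proof (cases "target (length (vs @ vs')) \<le> W")
      case True
      have "c \<le> brushes V b' + 14 * (K * \<eta>)"
        using stopped_game[OF h' W True _ g'] db d D by simp
      then show ?thesis by (simp add: add_increasing2)
    next
      case False
      have dle: "water D' b' W \<le> n + 1" using dD' by simp
      from h' W(1) False g' dle show ?thesis
      proof (elim raise_or_stop[of "vs @ vs'" D' B' b' W c])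
        assume "c \<le> brushes V b' + 14 * (K * \<eta>)"
        then show ?thesis by (simp add: add_increasing2)
      next
        fix W' assume W': "W \<le> W'" "W' \<le> target (length (vs @ vs'))" "water D' b' W' = n + 1"
        show ?thesis
        proof (rule min_turn[OF _ h' W'(3) _ W'(2)])
          fix x assume x: "x \<le> num_above b' W'" "2 * x \<le> n"
          have "c \<le> lower_potential x b' W" using g' x by (auto simp: potential_ge_def)
          moreover have "lower_potential x b' W + weight (n + W' / p) (real n - x) \<le> lower_potential x b' W' + 18 / n"
            using D' D W W' dD' target_le[of "length (vs @ vs')"] x
            by (intro lower_potential_raise[of D']) auto
          ultimately show "c + weight (n + W' / p) (real n - x) \<le> lower_potential x b' W' + 18 / n" by simp
        qed (use less.hyps gl W W' in auto)
      qed auto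
    qed
    also have "\<dots> \<le> brushes V b + 14 * (K * \<eta>) + (1 + (1 + 90 / n) * game_length E True (D', B'))"
      unfolding br by simp
    also have "1 + (1 + 90 / n) * game_length E True (D', B') \<le>
        (1 + 90 / n) * real (1 + game_length E True (D', B'))"
      by (simp add: distrib_left)
    also have "\<dots> \<le> (1 + 90 / n) * game_length E False (D, B)"
      using gl by (intro mult_left_mono of_nat_mono) auto
    finally show "c \<le> brushes V b + 14 * (K * \<eta>) + (1 + 90 / n) * game_length E False (D, B)"
      by simp
  qed
qed

text \<open>
  The induction starts with \<open>(n + 1) / n\<close> as level, where no vertex sticks out.  The upper bound
  for the game brush number shows that the factor \<open>1 + 90 / n\<close> is harmless.
\<close>

theorem game_brush_number_lower:
  "p * n\<^sup>2 / exp 1 - 2000 * (p * n\<^sup>2 / K) \<le> game_brush_number V E"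
proof -
  define W where "W = (n + 1) / real n"
  have n0: "0 < real n" using n16 by simp
  have W: "0 \<le> W" "W \<le> 2" using n0 n16 by (auto simp: W_def field_simps)
  have "history E V [] V (\<lambda>_. 0) (\<lambda>_. 0)" by (simp add: history_def nbrs_def)
  moreover have "water V (\<lambda>_. 0) W = n + 1" using W n0 by (simp add: water_def W_def)
  moreover have "W \<le> target (length [])" using W K by (simp add: target_def)
  moreover have "p * n\<^sup>2 / exp 1 - 9 + weight (n + W / p) (real n - x) \<le> lower_potential x (\<lambda>_. 0) W + 18 / n"
    if "x \<le> num_above (\<lambda>_. 0) W" for x
  proof -
    have x: "x = 0" using that W by (simp add: num_above_def)
    have "W \<le> p * n" using W K by simp
    then have "weight (n + W / p) (real n) \<le> 9"
      using kappa_bounds[OF W(1)] n0 by (intro weight_le[of n]) auto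
    moreover have "p * n\<^sup>2 / exp 1 \<le> flat_value p (n + W / p) n"
    proof -
      have "exp (- 1) \<le> weight (n + W / p) n"
        using n0 W p by (simp add: weight_def add_divide_distrib)
      then have "p * n\<^sup>2 * exp (- 1) \<le> p * n\<^sup>2 * weight (n + W / p) n"
        using p by (intro mult_left_mono) auto
      then show ?thesis by (simp add: flat_value_def exp_minus divide_inverse)
    qed
    moreover have "0 \<le> 18 / real n" by simp
    moreover have "0 \<le> weight (n + W / p) (real n) * shortfall 0 (\<lambda>_. 0) W" by simp
    ultimately show ?thesis unfolding x lower_potential_def of_nat_0 diff_zero by linarith
  qed
  ultimately have "p * n\<^sup>2 / exp 1 - 9 \<le> brushes V (\<lambda>_. 0) + 14 * (K * \<eta>) +
      (1 + 90 / n) * game_length E True (V, \<lambda>_. 0)"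
    using W(1) max_turn_bound by (intro min_turn[of V "\<lambda>_. 0" "[]" "\<lambda>_. 0" W]) auto
  then have main: "p * n\<^sup>2 / exp 1 - 9 \<le> 14 * (K * \<eta>) + (1 + 90 / n) * game_brush_number V E"
    by (simp add: game_brush_number_def brushes_def)
  define g where "g = real (game_brush_number V E)"
  have K\<eta>: "K * \<eta> = p * n\<^sup>2 / K" by (simp add: \<eta>_def power2_eq_square)
  have pn2: "p * n\<^sup>2 = K * (K * \<eta>)" using K by (simp add: \<eta>_def power2_eq_square)
  have "g \<le> p * n\<^sup>2 / exp 1 + 230 * (K * \<eta>)"
    using game_brush_number_upper by (simp add: g_def K\<eta>)
  also have "p * n\<^sup>2 / exp 1 \<le> p * n\<^sup>2 / 1" using p by (intro divide_left_mono) auto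
  also have "\<dots> = K * (K * \<eta>)" using pn2 by simp
  finally have "90 / n * g \<le> 90 / n * (K * (K * \<eta>) + 230 * (K * \<eta>))"
    by (intro mult_left_mono) auto
  also have "\<dots> = 90 * (K / n) * (K * \<eta>) + 90 * 230 / n * (K * \<eta>)" by (simp add: algebra_simps)
  also have "\<dots> \<le> 90 * 1 * (K * \<eta>) + 90 * 230 / 16 * (K * \<eta>)"
  proof (intro add_mono mult_right_mono mult_left_mono)
    have "K \<le> K\<^sup>2" by (simp add: power2_eq_square)
    then have "K \<le> n" using K(2) by linarith
    then show "K / n \<le> 1" using n0 by simp
    show "90 * 230 / real n \<le> 90 * 230 / 16" using n16 by (intro divide_left_mono) auto
  qed (use \<eta>_bounds(1) in auto)
  finally have "90 / n * g \<le> 90 * 1 * (K * \<eta>) + 90 * 230 / 16 * (K * \<eta>)" .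
  moreover have "0 \<le> K * \<eta>" using \<eta>_bounds(1) by simp
  ultimately have "90 / n * g \<le> 1384 * (K * \<eta>)" by linarith
  moreover have "p * n\<^sup>2 / exp 1 - 9 \<le> 14 * (K * \<eta>) + g + 90 / n * g"
    using main by (simp add: g_def distrib_right)
  ultimately show ?thesis
    using \<eta>_bounds(4) n16 unfolding g_def[symmetric] K\<eta>[symmetric] by linarith
qed

end

section \<open>Pseudorandomness of the random graph\<close>

definition inner_edges :: "nat set set \<Rightarrow> nat set \<Rightarrow> nat set set" where
  "inner_edges E S = {e\<in>E. e \<subseteq> S}"

lemma edge_count_self:
  assumes "E \<subseteq> complete_edges n" "finite S"
  shows "edge_count E S S = 2 * card (inner_edges E S)"
proof -
  have finE: "finite E" using assms finite_complete_edges finite_subset by blast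
  have c2: "card e = 2" if "e \<in> E" for e using that assms by (auto simp: complete_edges_def)
  have "card (nbrs E S u) = card {e\<in>inner_edges E S. u \<in> e}" if u: "u \<in> S" for u
  proof (rule bij_betw_same_card[of "\<lambda>v. {v, u}"], unfold bij_betw_def, intro conjI)
    show "inj_on (\<lambda>v. {v, u}) (nbrs E S u)" by (auto simp: inj_on_def doubleton_eq_iff)
    show "(\<lambda>v. {v, u}) ` nbrs E S u = {e\<in>inner_edges E S. u \<in> e}"
    proof (intro equalityI subsetI)
      fix e assume e: "e \<in> {e\<in>inner_edges E S. u \<in> e}"
      then have "card e = 2" using c2 by (auto simp: inner_edges_def)
      then obtain a b where "e = {a, b}" by (auto simp: card_2_iff)
      then show "e \<in> (\<lambda>v. {v, u}) ` nbrs E S u"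
        using e by (auto simp: inner_edges_def nbrs_def insert_commute)
    qed (use u in \<open>auto simp: inner_edges_def nbrs_def\<close>)
  qed
  then have "edge_count E S S = (\<Sum>u\<in>S. card {e\<in>inner_edges E S. u \<in> e})"
    by (simp add: edge_count_def)
  also have "\<dots> = 2 * card (inner_edges E S)"
  proof (rule sum_multicount)
    show "\<forall>e\<in>inner_edges E S. card {u\<in>S. u \<in> e} = 2"
    proof
      fix e assume e: "e \<in> inner_edges E S"
      then have "{u\<in>S. u \<in> e} = e" by (auto simp: inner_edges_def)
      then show "card {u\<in>S. u \<in> e} = 2" using e c2 by (simp add: inner_edges_def)
    qed
  qed (use assms finE in \<open>auto simp: inner_edges_def\<close>)
  finally show ?thesis .
qed

text \<open>
  Inclusion and exclusion: only the number of edges inside single sets has to be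
  controlled, which is a sum of independent indicators.
\<close>

lemma edge_count_eq_self:
  assumes "finite S" "finite T"
  shows "2 * real (edge_count E S T) =
    real (edge_count E (S \<union> T) (S \<union> T)) + real (edge_count E (S \<inter> T) (S \<inter> T))
    - real (edge_count E (S - T) (S - T)) - real (edge_count E (T - S) (T - S))"
proof -
  define A B C where "A = S - T" and "B = T - S" and "C = S \<inter> T"
  have fin: "finite A" "finite B" "finite C" and disj: "A \<inter> B = {}" "A \<inter> C = {}" "C \<inter> B = {}"
    and eq: "S = A \<union> C" "T = C \<union> B" "S \<union> T = (A \<union> C) \<union> B" "S \<inter> T = C" "S - T = A" "T - S = B"
    using assms by (auto simp: A_def B_def C_def)
  have d: "(A \<union> C) \<inter> B = {}" using disj by auto
  show ?thesis
    unfolding eq(3-6) unfolding eq(1,2)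
    using fin disj d edge_count_commute[of A B E] edge_count_commute[of A C E] edge_count_commute[of C B E]
    by (simp add: edge_count_Un_left edge_count_Un_right)
qed

lemma density_from_self:
  assumes "0 \<le> c" "\<And>S. S \<subseteq> V \<Longrightarrow> \<bar>real (edge_count E S S) - p * (real (card S))\<^sup>2\<bar> \<le> c"
    and "finite V" "S \<subseteq> V" "T \<subseteq> V"
  shows "\<bar>real (edge_count E S T) - p * card S * card T\<bar> \<le> 2 * c"
proof -
  have fin: "finite S" "finite T"
    using finite_subset[OF assms(4,3)] finite_subset[OF assms(5,3)] .
  have "card (S \<union> T) = card (S - T) + card (T - S) + card (S \<inter> T)"
    using fin by (subst card_Un_disjoint[symmetric], auto)+ (auto intro: arg_cong[of _ _ card])
  moreover have "card S = card (S - T) + card (S \<inter> T)" "card T = card (T - S) + card (S \<inter> T)"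
    using fin by (subst card_Un_disjoint[symmetric]; auto intro: arg_cong[of _ _ card])+
  ultimately have "2 * (p * card S * card T) = p * (real (card (S \<union> T)))\<^sup>2 + p * (real (card (S \<inter> T)))\<^sup>2
      - p * (real (card (S - T)))\<^sup>2 - p * (real (card (T - S)))\<^sup>2"
    by (simp add: power2_eq_square algebra_simps)
  moreover have "S \<union> T \<subseteq> V" "S \<inter> T \<subseteq> V" "S - T \<subseteq> V" "T - S \<subseteq> V" using assms by auto
  note this[THEN assms(2)]
  ultimately show ?thesis using edge_count_eq_self[OF fin, of E] by linarith
qed

lemma exp_quadratic:
  fixes t :: real
  assumes "\<bar>t\<bar> \<le> 1"
  shows "exp t \<le> 1 + t + t\<^sup>2"
proof (cases "0 \<le> t")
  case True
  then show ?thesis using exp_bound[of t] assms by simp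
next
  case False
  have "exp (- (- t)) \<le> 1 - (- t) + (- t)\<^sup>2 / 2" using False by (intro exp_minus_le) simp
  also have "\<dots> \<le> 1 + t + t\<^sup>2" by simp
  finally show ?thesis by simp
qed

text \<open>
  The factors of the moment generating function are bounded by means of
  \<open>exp t - 1 \<le> t + t\<^sup>2\<close>, which treats both tails at once.
\<close>

lemma mgf_bernoulli_count:
  fixes t q :: real
  assumes "finite A" "F \<subseteq> A" "0 \<le> q" "q \<le> 1" "\<bar>t\<bar> \<le> 1"
  shows "measure_pmf.expectation (Pi_pmf A False (\<lambda>_. bernoulli_pmf q)) (\<lambda>X. exp (t * card {e\<in>F. X e}))
    \<le> exp (q * card F * (t + t\<^sup>2))"
proof -
  have finF: "finite F" using assms finite_subset by blast
  have eq: "(\<lambda>X. exp (t * card {e\<in>F. X e})) = (\<lambda>X. \<Prod>e\<in>A. if e \<in> F \<and> X e then exp t else 1)"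
  proof
    fix X
    have "(\<Prod>e\<in>A. if e \<in> F \<and> X e then exp t else 1) = (\<Prod>e\<in>{e\<in>F. X e}. exp t)"
      using assms by (intro prod.mono_neutral_cong_right) auto
    also have "\<dots> = exp (t * card {e\<in>F. X e})" by (simp add: exp_of_nat_mult[symmetric] mult.commute)
    finally show "exp (t * card {e\<in>F. X e}) = (\<Prod>e\<in>A. if e \<in> F \<and> X e then exp t else 1)" by simp
  qed
  have "measure_pmf.expectation (Pi_pmf A False (\<lambda>_. bernoulli_pmf q)) (\<lambda>X. exp (t * card {e\<in>F. X e})) =
      (\<Prod>e\<in>A. measure_pmf.expectation (bernoulli_pmf q) (\<lambda>x. if e \<in> F \<and> x then exp t else 1))"
    unfolding eq using assms(1) by (intro expectation_prod_Pi_pmf integrable_measure_pmf_finite) auto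
  also have "\<dots> = (\<Prod>e\<in>A. if e \<in> F then 1 + q * (exp t - 1) else 1)"
    using assms(3,4) by (intro prod.cong) (auto simp: algebra_simps)
  also have "\<dots> = (\<Prod>e\<in>F. 1 + q * (exp t - 1))"
    using assms by (intro prod.mono_neutral_cong_right) auto
  also have "\<dots> \<le> (\<Prod>e\<in>F. exp (q * (t + t\<^sup>2)))"
  proof (intro prod_mono conjI)
    have "0 \<le> (1 - q) + q * exp t" using assms by simp
    then show "0 \<le> 1 + q * (exp t - 1)" by (simp add: algebra_simps)
    have "q * (exp t - 1) \<le> q * (t + t\<^sup>2)"
      using exp_quadratic[OF assms(5)] assms(3) by (intro mult_left_mono) auto
    also have "1 + \<dots> \<le> exp \<dots>" by (rule exp_ge_add_one_self)
    finally show "1 + q * (exp t - 1) \<le> exp (q * (t + t\<^sup>2))" by simp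
  qed
  also have "\<dots> = exp (q * card F * (t + t\<^sup>2))"
    by (simp add: exp_of_nat_mult[symmetric] ac_simps)
  finally show ?thesis .
qed

lemma bernoulli_count_tail:
  fixes t q a :: real
  assumes "finite A" "F \<subseteq> A" "0 \<le> q" "q \<le> 1" "\<bar>t\<bar> \<le> 1"
  shows "measure_pmf.prob (Pi_pmf A False (\<lambda>_. bernoulli_pmf q))
      {X. t * (q * card F) + a \<le> t * card {e\<in>F. X e}} \<le> exp (q * card F * t\<^sup>2 - a)"
proof -
  let ?M = "Pi_pmf A False (\<lambda>_. bernoulli_pmf q)"
  let ?f = "\<lambda>X. exp (t * card {e\<in>F. X e})"
  let ?c = "exp (t * (q * card F) + a)"
  have "finite (set_pmf ?M)" using assms(1) by (subst set_Pi_pmf) auto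
  then have "measure_pmf.prob ?M {X\<in>space ?M. ?c \<le> ?f X} \<le> measure_pmf.expectation ?M ?f / ?c"
    by (intro integral_Markov_inequality_measure[where A = "{}"]) (auto intro: integrable_measure_pmf_finite)
  also have "\<dots> \<le> exp (q * card F * (t + t\<^sup>2)) / ?c"
    using mgf_bernoulli_count[OF assms] by (intro divide_right_mono) auto
  also have "\<dots> = exp (q * card F * t\<^sup>2 - a)"
    by (simp flip: exp_diff) (simp add: algebra_simps)
  finally show ?thesis by simp
qed

text \<open>
  The exponent is proportional to \<open>q N\<close>, the order of the expected number of edges.  This beats the
  \<open>2\<^sup>n\<close> sets for sparse graphs also, which a bound in terms of the number of possible edges would not.
\<close>

lemma bernoulli_count_deviation:
  fixes \<delta> q N :: real
  assumes "finite A" "F \<subseteq> A" "0 \<le> q" "q \<le> 1" "0 \<le> \<delta>" "\<delta> \<le> 1" "2 * card F \<le> N"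
  shows "measure_pmf.prob (Pi_pmf A False (\<lambda>_. bernoulli_pmf q))
      {X. \<delta> * q * N \<le> \<bar>real (card {e\<in>F. X e}) - q * card F\<bar>} \<le> 2 * exp (- \<delta>\<^sup>2 * q * N / 2)"
proof -
  let ?M = "Pi_pmf A False (\<lambda>_. bernoulli_pmf q)"
  let ?B = "\<lambda>t. {X. t * (q * card F) + \<delta>\<^sup>2 * q * N \<le> t * card {e\<in>F. X e}}"
  have tail: "measure_pmf.prob ?M (?B t) \<le> exp (- \<delta>\<^sup>2 * q * N / 2)" if "t = \<delta> \<or> t = - \<delta>" for t
  proof -
    have "measure_pmf.prob ?M (?B t) \<le> exp (q * card F * t\<^sup>2 - \<delta>\<^sup>2 * q * N)"
      using assms that by (intro bernoulli_count_tail) auto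
    also have "q * card F * t\<^sup>2 \<le> q * (N / 2) * \<delta>\<^sup>2"
      using assms that by (intro mult_mono) auto
    then have "exp (q * card F * t\<^sup>2 - \<delta>\<^sup>2 * q * N) \<le> exp (- \<delta>\<^sup>2 * q * N / 2)"
      by (simp add: algebra_simps)
    finally show ?thesis .
  qed
  have "{X. \<delta> * q * N \<le> \<bar>real (card {e\<in>F. X e}) - q * card F\<bar>} \<subseteq> ?B \<delta> \<union> ?B (- \<delta>)"
  proof
    fix X assume "X \<in> {X. \<delta> * q * N \<le> \<bar>real (card {e\<in>F. X e}) - q * card F\<bar>}"
    then consider "\<delta> * q * N \<le> real (card {e\<in>F. X e}) - q * card F"
      | "\<delta> * q * N \<le> q * card F - real (card {e\<in>F. X e})" by (auto simp: abs_if split: if_splits)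
    then show "X \<in> ?B \<delta> \<union> ?B (- \<delta>)"
    proof cases
      case 1
      then show ?thesis using mult_left_mono[OF 1 assms(5)] by (simp add: power2_eq_square algebra_simps)
    next
      case 2
      then show ?thesis using mult_left_mono[OF 2 assms(5)] by (simp add: power2_eq_square algebra_simps)
    qed
  qed
  then have "measure_pmf.prob ?M {X. \<delta> * q * N \<le> \<bar>real (card {e\<in>F. X e}) - q * card F\<bar>}
      \<le> measure_pmf.prob ?M (?B \<delta> \<union> ?B (- \<delta>))"
    by (intro measure_pmf.finite_measure_mono) auto
  also have "\<dots> \<le> measure_pmf.prob ?M (?B \<delta>) + measure_pmf.prob ?M (?B (- \<delta>))"
    by (intro measure_Un_le) auto
  also have "\<dots> \<le> exp (- \<delta>\<^sup>2 * q * N / 2) + exp (- \<delta>\<^sup>2 * q * N / 2)"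
    by (intro add_mono tail) auto
  finally show ?thesis by simp
qed

lemma two_mult_choose_two: "2 * (k choose 2) = k * (k - 1)"
proof -
  have "even (k * (k - 1))" by (cases k) auto
  then show ?thesis by (simp add: choose_two)
qed

lemma random_graph_deviation:
  fixes \<delta> q :: real
  assumes "0 \<le> q" "q \<le> 1" "0 \<le> \<delta>" "\<delta> \<le> 1"
  shows "measure_pmf.prob (random_graph n q)
      {E. \<exists>S\<subseteq>{1..n}. \<delta> * q * n\<^sup>2 \<le> \<bar>real (card (inner_edges E S)) - q * (card S choose 2)\<bar>}
    \<le> 2 ^ n * (2 * exp (- \<delta>\<^sup>2 * q * n\<^sup>2 / 2))"
proof -
  let ?A = "complete_edges n"
  let ?M = "Pi_pmf ?A False (\<lambda>_. bernoulli_pmf q)"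
  define F where "F = (\<lambda>S. {e\<in>?A. e \<subseteq> S})"
  let ?B = "\<lambda>S. {X. \<delta> * q * (real n)\<^sup>2 \<le> \<bar>real (card {e\<in>F S. X e}) - q * card (F S)\<bar>}"
  have cF: "card (F S) = card S choose 2" if "S \<subseteq> {1..n}" for S
  proof -
    have "F S = {e. e \<subseteq> S \<and> card e = 2}" using that by (auto simp: F_def complete_edges_def)
    then show ?thesis using n_subsets[of S 2] finite_subset[OF that] by simp
  qed
  have B: "measure_pmf.prob ?M (?B S) \<le> 2 * exp (- \<delta>\<^sup>2 * q * (real n)\<^sup>2 / 2)" if S: "S \<in> Pow {1..n}" for S
  proof (rule bernoulli_count_deviation[OF finite_complete_edges _ assms])
    show "F S \<subseteq> ?A" by (auto simp: F_def)
    have "card (F S) \<le> n choose 2"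
      unfolding card_complete_edges[symmetric] by (intro card_mono finite_complete_edges) (auto simp: F_def)
    then have "2 * card (F S) \<le> n * (n - 1)" using two_mult_choose_two[of n] by linarith
    also have "\<dots> \<le> n * n" by (intro mult_left_mono) auto
    finally have "real (2 * card (F S)) \<le> real (n * n)" by (rule of_nat_mono)
    then show "real (2 * card (F S)) \<le> (real n)\<^sup>2" by (simp add: power2_eq_square)
  qed
  have "measure_pmf.prob (random_graph n q)
      {E. \<exists>S\<subseteq>{1..n}. \<delta> * q * n\<^sup>2 \<le> \<bar>real (card (inner_edges E S)) - q * (card S choose 2)\<bar>}
      = measure_pmf.prob ?M (\<Union>S\<in>Pow {1..n}. ?B S)"
  proof -
    have "inner_edges {e\<in>?A. X e} S = {e\<in>F S. X e}" for X S by (auto simp: inner_edges_def F_def)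
    then show ?thesis using cF
      by (auto simp: random_graph_def intro!: arg_cong[of _ _ "measure_pmf.prob ?M"])
  qed
  also have "\<dots> \<le> (\<Sum>S\<in>Pow {1..n}. measure_pmf.prob ?M (?B S))"
    by (intro measure_pmf.finite_measure_subadditive_finite) auto
  also have "\<dots> \<le> (\<Sum>S\<in>Pow {1..n}. 2 * exp (- \<delta>\<^sup>2 * q * (real n)\<^sup>2 / 2))" by (intro sum_mono B)
  also have "\<dots> = 2 ^ n * (2 * exp (- \<delta>\<^sup>2 * q * n\<^sup>2 / 2))" by (simp add: card_Pow)
  finally show ?thesis .
qed

lemma pseudorandom_from_deviation:
  fixes q :: real
  assumes q: "0 < q" "q \<le> 1" and K: "4 \<le> K" "6 * K\<^sup>2 \<le> n" "K \<le> q * n"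
    and E: "E \<subseteq> complete_edges n"
    and dev: "\<And>S. S \<subseteq> {1..n} \<Longrightarrow>
      \<bar>real (card (inner_edges E S)) - q * (card S choose 2)\<bar> \<le> 1 / (6 * K\<^sup>2) * q * n\<^sup>2"
  shows "pseudorandom n K q E"
proof
  show "0 < q" "q \<le> 1" "4 \<le> K" "K\<^sup>2 \<le> n" "K \<le> q * n" using q K by auto
  define c where "c = q * n\<^sup>2 / (2 * K\<^sup>2)"
  have "\<bar>real (edge_count E S S) - q * (real (card S))\<^sup>2\<bar> \<le> c" if S: "S \<subseteq> {1..n}" for S
  proof -
    have cS: "card S \<le> n" using card_mono[of "{1..n}" S] S by simp
    have "2 * real (card S choose 2) = (real (card S))\<^sup>2 - card S"
    proof -
      have "real (2 * (card S choose 2)) = real (card S * (card S - 1))"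
        by (simp only: two_mult_choose_two)
      then show ?thesis by (cases "card S") (simp_all add: power2_eq_square algebra_simps)
    qed
    then have "q * (real (card S))\<^sup>2 = 2 * (q * (card S choose 2)) + q * card S"
      by (metis add.commute diff_add_cancel distrib_left mult.left_commute)
    moreover have "real (edge_count E S S) = 2 * real (card (inner_edges E S))"
      using edge_count_self[OF E finite_subset[OF S]] by simp
    moreover have "0 \<le> q * card S" using q by simp
    moreover have "q * card S \<le> q * n" using q cS by (intro mult_left_mono) auto
    moreover have "q * n \<le> 1 / (6 * (real K)\<^sup>2) * q * (real n)\<^sup>2"
    proof -
      have "real (6 * K\<^sup>2) \<le> real n" using K(2) by (rule of_nat_mono)
      then have "q * n * (6 * (real K)\<^sup>2) \<le> q * n * n" using q by (intro mult_left_mono) auto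
      then show ?thesis using K(1) by (simp add: field_simps power2_eq_square)
    qed
    moreover have "c = 3 * (1 / (6 * (real K)\<^sup>2) * q * (real n)\<^sup>2)" by (simp add: c_def)
    ultimately show ?thesis using dev[OF S] by linarith
  qed
  moreover have "0 \<le> c" using q by (simp add: c_def)
  ultimately have "\<bar>real (edge_count E S T) - q * card S * card T\<bar> \<le> 2 * c"
    if "S \<subseteq> {1..n}" "T \<subseteq> {1..n}" for S T
    using that by (intro density_from_self[of c "{1..n}"]) auto
  then show "\<bar>real (edge_count E S T) - q * real (card S) * real (card T)\<bar> \<le> q * real (n\<^sup>2) / real (K\<^sup>2)"
    if "S \<subseteq> {1..n}" "T \<subseteq> {1..n}" for S T
    using that by (simp add: c_def)
qed

lemma pseudorandom_complete:
  assumes "4 \<le> K" "K\<^sup>2 \<le> n"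
  shows "pseudorandom n K 1 (complete_edges n)"
proof
  show "4 \<le> K" "K\<^sup>2 \<le> n" using assms by auto
  have "K \<le> K\<^sup>2" by (simp add: power2_eq_square)
  then show "real K \<le> 1 * real n" using assms by simp
  fix S T assume S: "S \<subseteq> {1..n}" and T: "T \<subseteq> {1..n}"
  have fin: "finite T" "finite S" using S T finite_subset by auto
  have "nbrs (complete_edges n) T u = T - {u}" if "u \<in> S" for u
    using that S T by (auto simp: nbrs_def complete_edges_def card_2_iff doubleton_eq_iff)
  then have "real (edge_count (complete_edges n) S T) = (\<Sum>u\<in>S. real (card (T - {u})))"
    by (simp add: edge_count_def)
  moreover have "(\<Sum>u\<in>S. real (card (T - {u}))) \<le> (\<Sum>u\<in>S. real (card T))"
    by (intro sum_mono of_nat_mono card_Diff1_le)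
  moreover have "(\<Sum>u\<in>S. real (card T) - 1) \<le> (\<Sum>u\<in>S. real (card (T - {u})))"
    using fin by (intro sum_mono) (auto simp: card_Diff_singleton_if)
  moreover have "real (card S) \<le> n" using card_mono[OF _ S] by simp
  moreover have "real n \<le> n\<^sup>2 / K\<^sup>2"
  proof -
    have "real n * real (K\<^sup>2) \<le> real n * real n" using assms by (intro mult_left_mono of_nat_mono) auto
    then show ?thesis using assms by (simp add: field_simps power2_eq_square)
  qed
  ultimately show "\<bar>real (edge_count (complete_edges n) S T) - 1 * real (card S) * real (card T)\<bar>
      \<le> 1 * real (n\<^sup>2) / real (K\<^sup>2)"
    by (simp add: right_diff_distrib abs_le_iff)
qed auto

text \<open>
  The asymptotic value may be replaced by an equivalent one, which deduces the claim about \<open>p b\<^sub>g(K\<^sub>n)\<close> from the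
  one about \<open>p n\<^sup>2 / e\<close>.
\<close>

lemma aas_asymp_cong:
  assumes X: "aas_asymp M X a" and a: "a' \<sim>[sequentially] a" and pos: "eventually (\<lambda>n. 0 < a n) sequentially"
  shows "aas_asymp M X a'"
  unfolding aas_asymp_def
proof (intro allI impI)
  fix \<epsilon> :: real assume \<epsilon>: "0 < \<epsilon>"
  define d where "d = min (1 / 2) (\<epsilon> / 4)"
  have d: "0 < d" "d \<le> 1 / 2" "4 * d \<le> \<epsilon>" using \<epsilon> by (auto simp: d_def)
  have "((\<lambda>n. a' n / a n) \<longlongrightarrow> 1) sequentially"
    using a pos by (intro asymp_equivD_strong) (auto elim: eventually_mono)
  then have "eventually (\<lambda>n. dist (a' n / a n) 1 < d) sequentially" using d by (auto dest: tendstoD)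
  then have close: "eventually (\<lambda>n. \<bar>a' n - a n\<bar> \<le> d * a n \<and> 0 < a n) sequentially"
    using pos
  proof eventually_elim
    case (elim n)
    have "a' n - a n = (a' n / a n - 1) * a n" using elim by (simp add: field_simps)
    then have "\<bar>a' n - a n\<bar> = \<bar>a' n / a n - 1\<bar> * a n" using elim by (simp add: abs_mult)
    then show ?case using elim by (simp add: dist_real_def mult_right_mono)
  qed
  have lower: "eventually (\<lambda>n. measure_pmf.prob (M n) {\<omega>. \<bar>X n \<omega> - a n\<bar> \<le> d * a n} \<le>
      measure_pmf.prob (M n) {\<omega>. \<bar>X n \<omega> - a' n\<bar> \<le> \<epsilon> * a' n}) sequentially"
    using close
  proof eventually_elim
    case (elim n)
    have "d * a n \<le> 1 / 2 * a n" using elim d by (intro mult_right_mono) auto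
    then have "a n \<le> 2 * a' n" using elim by linarith
    then have "2 * d * a n \<le> 2 * d * (2 * a' n)" using d by (intro mult_left_mono) auto
    also have "\<dots> = 4 * d * a' n" by simp
    also have "\<dots> \<le> \<epsilon> * a' n" using d elim \<open>a n \<le> 2 * a' n\<close> by (intro mult_right_mono) auto
    finally have "2 * (d * a n) \<le> \<epsilon> * a' n" by simp
    then show ?case using elim by (intro measure_pmf.finite_measure_mono) auto
  qed
  have lim: "(\<lambda>n. measure_pmf.prob (M n) {\<omega>. \<bar>X n \<omega> - a n\<bar> \<le> d * a n}) \<longlonglongrightarrow> 1"
    using X d by (simp add: aas_asymp_def)
  show "(\<lambda>n. measure_pmf.prob (M n) {\<omega>. \<bar>X n \<omega> - a' n\<bar> \<le> \<epsilon> * a' n}) \<longlonglongrightarrow> 1"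
    by (rule tendsto_sandwich[OF lower _ lim tendsto_const]) auto
qed

section \<open>The game brush number of the random graph\<close>

lemma (in pseudorandom) game_brush_number_bounds:
  "\<bar>real (game_brush_number V E) - p * n\<^sup>2 / exp 1\<bar> \<le> 2000 * (p * n\<^sup>2 / K)"
proof -
  have "0 \<le> p * n\<^sup>2 / K" using p by simp
  then show ?thesis using game_brush_number_lower game_brush_number_upper by linarith
qed

lemma random_graph_pseudorandom:
  fixes q :: real
  assumes q: "0 < q" "q \<le> 1" and K: "4 \<le> K" "6 * K\<^sup>2 \<le> n" "144 * real K ^ 4 \<le> q * n"
  shows "1 - 2 * exp (- real n) \<le> measure_pmf.prob (random_graph n q) {E. pseudorandom n K q E}"
proof -
  define \<delta> where "\<delta> = 1 / (6 * (real K)\<^sup>2)"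
  let ?M = "random_graph n q"
  define bad where
    "bad = {E. \<exists>S\<subseteq>{1..n}. \<delta> * q * n\<^sup>2 \<le> \<bar>real (card (inner_edges E S)) - q * (card S choose 2)\<bar>}"
  have K1: "1 \<le> real K" using K by simp
  have \<delta>: "0 \<le> \<delta>" "\<delta> \<le> 1" using one_le_power[OF K1, of 2] by (auto simp: \<delta>_def divide_le_eq)
  have "measure_pmf.prob ?M bad \<le> 2 ^ n * (2 * exp (- \<delta>\<^sup>2 * q * n\<^sup>2 / 2))"
    unfolding bad_def using q \<delta> by (intro random_graph_deviation) auto
  also have "\<dots> \<le> exp (real n) * (2 * exp (- 2 * real n))"
  proof (rule mult_mono)
    have "2 \<le> exp (1::real)" using exp_ge_add_one_self[of 1] by simp
    then have "2 ^ n \<le> exp (1::real) ^ n" by (intro power_mono) auto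
    then show "2 ^ n \<le> exp (real n)" by (simp flip: exp_of_nat_mult)
    \<comment> \<open>The exponential is at most \<open>exp (- 2 n)\<close> and so outweighs the number of sets.\<close>
    have "144 * real K ^ 4 * n \<le> q * n * n" using K(3) by (intro mult_right_mono) auto
    then have "2 * real n * (72 * real K ^ 4) \<le> q * (real n)\<^sup>2"
      by (simp add: power2_eq_square ac_simps)
    then have "2 * real n \<le> q * (real n)\<^sup>2 / (72 * real K ^ 4)"
      using K1 by (subst pos_le_divide_eq) auto
    also have "\<dots> = \<delta>\<^sup>2 * q * n\<^sup>2 / 2"
      by (simp add: \<delta>_def power_divide power_mult_distrib flip: power_mult)
    finally have "2 * real n \<le> \<delta>\<^sup>2 * q * n\<^sup>2 / 2" .
    then show "2 * exp (- \<delta>\<^sup>2 * q * n\<^sup>2 / 2) \<le> 2 * exp (- 2 * real n)" by simp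
  qed auto
  also have "\<dots> = 2 * exp (- real n)" by (simp flip: exp_add)
  finally have bad_le: "measure_pmf.prob ?M bad \<le> 2 * exp (- real n)" .
  have "1 - measure_pmf.prob ?M bad = measure_pmf.prob ?M (UNIV - bad)"
    using measure_pmf.prob_compl[of bad ?M] by simp
  also have "\<dots> = measure_pmf.prob ?M ((UNIV - bad) \<inter> set_pmf ?M)"
    by (rule measure_Int_set_pmf[symmetric])
  also have "\<dots> \<le> measure_pmf.prob ?M {E. pseudorandom n K q E}"
  proof (rule measure_pmf.finite_measure_mono)
    show "(UNIV - bad) \<inter> set_pmf ?M \<subseteq> {E. pseudorandom n K q E}"
    proof
      fix E assume E: "E \<in> (UNIV - bad) \<inter> set_pmf ?M"
      have "real K ^ 1 \<le> real K ^ 4" using K1 by (intro power_increasing) auto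
      then have "real K \<le> real K ^ 4" by (simp only: power_one_right)
      then have Kq: "K \<le> q * n" using K(3) K1 by linarith
      have sub: "E \<subseteq> complete_edges n"
      proof -
        have "E \<in> set_pmf ?M" using E by blast
        then show ?thesis by (auto simp: random_graph_def)
      qed
      have "pseudorandom n K q E"
      proof (rule pseudorandom_from_deviation[OF q K(1,2) Kq sub])
        fix S assume S: "S \<subseteq> {1..n}"
        have "E \<notin> bad" using E by blast
        then have "\<not> \<delta> * q * n\<^sup>2 \<le> \<bar>real (card (inner_edges E S)) - q * (card S choose 2)\<bar>"
          using S unfolding bad_def by blast
        then show "\<bar>real (card (inner_edges E S)) - q * (card S choose 2)\<bar> \<le> 1 / (6 * (real K)\<^sup>2) * q * (real n)\<^sup>2"
          unfolding \<delta>_def by (simp only: not_le of_nat_power less_imp_le)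
      qed
      then show "E \<in> {E. pseudorandom n K q E}" by simp
    qed
  qed simp
  finally show ?thesis using bad_le by linarith
qed

lemma ex_precision:
  assumes "0 < \<epsilon>"
  shows "\<exists>K\<ge>4 :: nat. \<forall>a\<ge>0. 2000 * (a / K) \<le> \<epsilon> * (a / exp 1)"
proof -
  obtain K :: nat where K: "max 4 (2000 * exp 1 / \<epsilon>) \<le> K" using real_arch_simple by blast
  then have K4: "4 \<le> K" by simp
  have "2000 * exp 1 \<le> \<epsilon> * K" using K assms by (simp add: divide_le_eq mult.commute)
  then have "2000 / K \<le> \<epsilon> / exp 1" using K4 by (simp add: field_simps)
  then have "2000 * (a / K) \<le> \<epsilon> * (a / exp 1)" if "0 \<le> a" for a
    using mult_left_mono[of "2000 / K" "\<epsilon> / exp 1" a] that by (simp add: mult.commute)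
  with K4 show ?thesis by (intro exI[of _ K]) simp
qed

lemma game_brush_number_complete:
  "(\<lambda>n. real (game_brush_number {1..n} (complete_edges n))) \<sim>[sequentially] (\<lambda>n. (real n)\<^sup>2 / exp 1)"
proof (rule asymp_equivI')
  show "(\<lambda>n. real (game_brush_number {1..n} (complete_edges n)) / ((real n)\<^sup>2 / exp 1)) \<longlonglongrightarrow> 1"
  proof (rule tendstoI)
    fix \<epsilon> :: real assume "0 < \<epsilon>"
    then have "0 < \<epsilon> / 2" by simp
    obtain K :: nat where prec: "4 \<le> K" "\<forall>a\<ge>0. 2000 * (a / K) \<le> \<epsilon> / 2 * (a / exp 1)"
      using ex_precision[OF \<open>0 < \<epsilon> / 2\<close>] by blast
    show "eventually (\<lambda>n. dist (real (game_brush_number {1..n} (complete_edges n)) / ((real n)\<^sup>2 / exp 1)) 1 < \<epsilon>) sequentially"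
      using eventually_ge_at_top[of "max 1 (K\<^sup>2)"]
    proof eventually_elim
      case (elim n)
      then interpret pseudorandom n K 1 "complete_edges n"
        using prec(1) by (intro pseudorandom_complete) auto
      let ?g = "real (game_brush_number {1..n} (complete_edges n))" and ?a = "(real n)\<^sup>2 / exp 1"
      have a: "0 < ?a" using elim by simp
      have "\<bar>?g - ?a\<bar> \<le> \<epsilon> / 2 * ?a"
        using game_brush_number_bounds prec(2)[rule_format, of "(real n)\<^sup>2"] by simp
      also have "\<dots> < \<epsilon> * ?a" using a \<open>0 < \<epsilon>\<close> by (intro mult_strict_right_mono) simp_all
      finally have "\<bar>?g - ?a\<bar> < \<epsilon> * ?a" .
      moreover have "\<bar>x / y - 1\<bar> < \<epsilon>" if "\<bar>x - y\<bar> < \<epsilon> * y" "0 < y" for x y :: real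
      proof -
        have "x / y - 1 = (x - y) / y" using that by (simp add: diff_divide_distrib)
        then show ?thesis using that by (simp add: pos_divide_less_eq)
      qed
      ultimately show ?case using a unfolding dist_real_def by blast
    qed
  qed
qed

lemma game_brush_number_random:
  fixes p :: "nat \<Rightarrow> real"
  assumes p: "\<And>n. n \<ge> 1 \<Longrightarrow> 0 < p n \<and> p n \<le> 1"
    and pn: "filterlim (\<lambda>n. p n * real n) at_top sequentially"
  shows "aas_asymp (\<lambda>n. random_graph n (p n)) (\<lambda>n E. real (game_brush_number {1..n} E))
           (\<lambda>n. p n * (real n)\<^sup>2 / exp 1)"
  unfolding aas_asymp_def
proof (intro allI impI)
  fix \<epsilon> :: real assume "0 < \<epsilon>"
  obtain K :: nat where prec: "4 \<le> K" "\<forall>a\<ge>0. 2000 * (a / K) \<le> \<epsilon> * (a / exp 1)"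
    using ex_precision[OF \<open>0 < \<epsilon>\<close>] by blast
  let ?P = "\<lambda>n. measure_pmf.prob (random_graph n (p n))
    {E. \<bar>real (game_brush_number {1..n} E) - p n * (real n)\<^sup>2 / exp 1\<bar> \<le> \<epsilon> * (p n * (real n)\<^sup>2 / exp 1)}"
  have "eventually (\<lambda>n. 144 * real K ^ 4 \<le> p n * n) sequentially"
    using pn by (simp add: filterlim_at_top)
  then have lower: "eventually (\<lambda>n. 1 - 2 * exp (- real n) \<le> ?P n) sequentially"
    using eventually_ge_at_top[of "max 1 (6 * K\<^sup>2)"]
  proof eventually_elim
    case (elim n)
    have q: "0 < p n" "p n \<le> 1" using p[of n] elim by auto
    have "1 - 2 * exp (- real n) \<le> measure_pmf.prob (random_graph n (p n)) {E. pseudorandom n K (p n) E}"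
      using q prec(1) elim by (intro random_graph_pseudorandom) auto
    also have "\<dots> \<le> ?P n"
    proof (intro measure_pmf.finite_measure_mono subsetI)
      fix E assume "E \<in> {E. pseudorandom n K (p n) E}"
      then interpret pseudorandom n K "p n" E by simp
      show "E \<in> {E. \<bar>real (game_brush_number {1..n} E) - p n * (real n)\<^sup>2 / exp 1\<bar> \<le> \<epsilon> * (p n * (real n)\<^sup>2 / exp 1)}"
        using game_brush_number_bounds prec(2)[rule_format, of "p n * (real n)\<^sup>2"] q by simp
    qed simp
    finally show ?case .
  qed
  have "(\<lambda>n. 1 - 2 * exp (- real n)) \<longlonglongrightarrow> 1 - 2 * 0"
    by (intro tendsto_intros filterlim_compose[OF exp_at_bot]
        filterlim_compose[OF filterlim_uminus_at_bot_at_top] filterlim_real_sequentially)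
  then have lim: "(\<lambda>n. 1 - 2 * exp (- real n)) \<longlonglongrightarrow> 1" by simp
  show "?P \<longlonglongrightarrow> 1"
    by (rule tendsto_sandwich[OF lower _ lim tendsto_const]) auto
qed

theorem theorem5:
  fixes p :: "nat \<Rightarrow> real"
  assumes "\<And>n. n \<ge> 1 \<Longrightarrow> 0 < p n \<and> p n \<le> 1"
    and "filterlim (\<lambda>n. p n * real n / ln (real n)) at_top sequentially"
  shows "aas_asymp (\<lambda>n. random_graph n (p n)) (\<lambda>n E. real (game_brush_number {1..n} E))
           (\<lambda>n. p n * real (game_brush_number {1..n} (complete_edges n)))
       \<and> aas_asymp (\<lambda>n. random_graph n (p n)) (\<lambda>n E. real (game_brush_number {1..n} E))
           (\<lambda>n. p n * (real n)\<^sup>2 / exp 1)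
       \<and> (\<lambda>n. p n * real (game_brush_number {1..n} (complete_edges n)))
           \<sim>[sequentially] (\<lambda>n. p n * (real n)\<^sup>2 / exp 1)"
proof (intro conjI)
  have pn: "filterlim (\<lambda>n. p n * real n) at_top sequentially"
  proof (rule filterlim_at_top_mono[OF assms(2)])
    show "eventually (\<lambda>n. p n * real n / ln (real n) \<le> p n * real n) sequentially"
      using eventually_ge_at_top[of 3]
    proof eventually_elim
      case (elim n)
      have "exp 1 \<le> real n" using exp_le elim by linarith
      then have "1 \<le> ln (real n)" using elim by (simp add: ln_ge_iff)
      moreover have "0 \<le> p n * n" using assms(1)[of n] elim by simp
      ultimately show ?case by (simp add: divide_le_eq mult_le_cancel_left1)
    qed
  qed
  show random: "aas_asymp (\<lambda>n. random_graph n (p n)) (\<lambda>n E. real (game_brush_number {1..n} E))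
      (\<lambda>n. p n * (real n)\<^sup>2 / exp 1)"
    by (rule game_brush_number_random[OF assms(1) pn])
  have "(\<lambda>n. p n * real (game_brush_number {1..n} (complete_edges n)))
      \<sim>[sequentially] (\<lambda>n. p n * ((real n)\<^sup>2 / exp 1))"
    by (intro asymp_equiv_intros game_brush_number_complete)
  then show complete: "(\<lambda>n. p n * real (game_brush_number {1..n} (complete_edges n)))
      \<sim>[sequentially] (\<lambda>n. p n * (real n)\<^sup>2 / exp 1)" by simp
  show "aas_asymp (\<lambda>n. random_graph n (p n)) (\<lambda>n E. real (game_brush_number {1..n} E))
      (\<lambda>n. p n * real (game_brush_number {1..n} (complete_edges n)))"
  proof (rule aas_asymp_cong[OF random complete])
    show "eventually (\<lambda>n. 0 < p n * (real n)\<^sup>2 / exp 1) sequentially"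
      using eventually_ge_at_top[of 1]
    proof eventually_elim
      case (elim n)
      then show ?case using assms(1)[of n] by simp
    qed
  qed
qed

end
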